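(* Let $\alpha\in\mathbb{R}$. A special class of exact solutions of the Weinstein equation in $\mathbb{R}^3$ $$x_2\,\Delta h-\alpha\,\frac{\partial h}{\partial x_2}=0\qquad(x_2>0)$$ satisfying the separation relations $$-g\,\frac{d^2 s}{dx_1^2}=s\Big(\frac{\partial^2 g}{\partial x_0^2}+\frac{\partial^2 g}{\partial x_2^2}\Big)-\frac{\alpha s}{x_2}\frac{\partial g}{\partial x_2}=\lambda^2 g s,$$ $$-\Upsilon\,\frac{d^2\Xi}{dx_0^2}=\Xi\,\frac{d^2\Upsilon}{dx_2^2}-\frac{\alpha\,\Xi}{x_2}\frac{d\Upsilon}{dx_2}-\lambda^2\,\Xi\,\Upsilon=-\beta^2\,\Xi\,\Upsilon,$$ with $\beta\notin\mathbb{Z}$, in three dimensional setting may be obtained using Bessel functions of the first and second kind: $$h_\beta(x_0,x_1,x_2)=\sum_{\lambda=-\infty}^{\infty}\big(C_{1,\lambda}\cos(\lambda x_1)+C_{2,\lambda}\sin(\lambda x_1)\big)\,g_{\lambda,\beta}(x_0,x_2),$$ where $$g_{\lambda,\beta}(x_0,x_2)=\big(B_{1,\beta}\cosh(\beta x_0)+B_{2,\beta}\sinh(\beta x_0)\big)\,\Upsilon_{\lambda,\beta}(x_2);$$ in case $\lambda^2<\beta^2$ $$\Upsilon_{\lambda,\beta}(x_2)=x_2^{\frac{\alpha+1}{2}}\Big[A_{1,\lambda,\beta}J_{\frac{\alpha+1}{2}}\big(x_2\sqrt{\beta^2-\lambda^2}\big)+A_{2,\lambda,\beta}Y_{\frac{\alpha+1}{2}}\big(x_2\sqrt{\beta^2-\lambda^2}\big)\Big],$$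 and in case $\lambda^2>\beta^2$ $$\Upsilon_{\lambda,\beta}(x_2)=x_2^{\frac{\alpha+1}{2}}\Big[A_{1,\lambda,\beta}J_{\frac{\alpha+1}{2}}\big(i x_2\sqrt{\lambda^2-\beta^2}\big)+A_{2,\lambda,\beta}Y_{\frac{\alpha+1}{2}}\big(i x_2\sqrt{\lambda^2-\beta^2}\big)\Big].$$
   Context: $\Delta=\partial^2/\partial x_0^2+\partial^2/\partial x_1^2+\partial^2/\partial x_2^2$ is the Euclidean Laplacian on $\mathbb{R}^3=\{(x_0,x_1,x_2)\}$. The separation relations arise by looking for solutions of the form $h(x_0,x_1,x_2)=g(x_0,x_2)\,s(x_1)$ with separation constant $\lambda$ (first relation), and then $g(x_0,x_2)=\Xi(x_0)\,\Upsilon(x_2)$ with separation constant $\beta\in\mathbb{R}$ (second relation); in the trigonometric solutions $s$ one takes $\lambda\in\mathbb{Z}$. $C_{1,\lambda},C_{2,\lambda},B_{1,\beta},B_{2,\beta},A_{1,\lambda,\beta},A_{2,\lambda,\beta}$ are real constants. $J_\nu$ and $Y_\nu$ denote the Bessel functions of the first and second kind of real order $\nu$ (here $\nu=\frac{\alpha+1}{2}$), of real argument in the first case and purely imaginary argument in the second. *)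

theory Defs
  imports "HOL-Analysis.Analysis"
begin

text \<open>
  Bessel functions of complex order, with the principal branch of the power. The value at
  \<open>z = 0\<close> is not meaningful, since \<open>0 powr \<nu> = 0\<close> in the library even for \<open>\<nu> = 0\<close>.
\<close>

definition bessel_J :: "complex \<Rightarrow> complex \<Rightarrow> complex" where
  "bessel_J \<nu> z =
     (z / 2) powr \<nu> * (\<Sum>k. (-1) ^ k * rGamma (\<nu> + of_nat k + 1) / fact k * (z / 2) ^ (2 * k))"

definition bessel_Y :: "complex \<Rightarrow> complex \<Rightarrow> complex" where
  "bessel_Y \<nu> z =
     (let Y = (\<lambda>\<mu>. (bessel_J \<mu> z * cos (of_real pi * \<mu>) - bessel_J (- \<mu>) z) / sin (of_real pi * \<mu>))
      in if \<nu> \<in> \<int> then Lim (at \<nu>) Y else Y \<nu>)"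

definition D1 :: "(real \<Rightarrow> 'a::real_normed_vector) \<Rightarrow> real \<Rightarrow> 'a" where
  "D1 f t = vector_derivative f (at t)"

definition D2 :: "(real \<Rightarrow> 'a::real_normed_vector) \<Rightarrow> real \<Rightarrow> 'a" where
  "D2 f = D1 (D1 f)"

text \<open>Intended for open \<open>S\<close>.\<close>

definition twice_differentiable_on :: "(real \<Rightarrow> 'a::real_normed_vector) \<Rightarrow> real set \<Rightarrow> bool" where
  "twice_differentiable_on f S \<longleftrightarrow>
     (\<forall>t\<in>S. f differentiable (at t) \<and> D1 f differentiable (at t))"

definition partial :: "'n::finite \<Rightarrow> (real^'n \<Rightarrow> 'a::real_normed_vector) \<Rightarrow> real^'n \<Rightarrow> 'a" where
  "partial i f x = frechet_derivative f (at x) (axis i 1)"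

text \<open>Class \<open>C\<^sup>2\<close>, for open \<open>S\<close>.\<close>

definition C2_on :: "(real^'n::finite \<Rightarrow> 'a::real_normed_vector) \<Rightarrow> (real^'n) set \<Rightarrow> bool" where
  "C2_on f S \<longleftrightarrow>
     (\<forall>x\<in>S. f differentiable (at x)) \<and>
     (\<forall>i. \<forall>x\<in>S. partial i f differentiable (at x)) \<and>
     (\<forall>i j. continuous_on S (partial j (partial i f)))"

definition laplacian :: "(real^'n::finite \<Rightarrow> 'a::real_normed_vector) \<Rightarrow> real^'n \<Rightarrow> 'a" where
  "laplacian f x = (\<Sum>i\<in>UNIV. partial i (partial i f) x)"

text \<open>
  Points of \<open>\<real>\<^sup>3\<close> are written \<open>(x$0, x$1, x$2)\<close>; the index type \<open>3\<close> is the integers modulo 3,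
  so \<open>0\<close>, \<open>1\<close>, \<open>2\<close> are its three elements (and \<open>0\<close> is the same index as \<open>3\<close>).
\<close>

definition upper_half_space :: "(real^3) set" where
  "upper_half_space = {x. x $ 2 > 0}"

definition weinstein_solution :: "real \<Rightarrow> (real^3 \<Rightarrow> complex) \<Rightarrow> bool" where
  "weinstein_solution \<alpha> h \<longleftrightarrow>
     C2_on h upper_half_space \<and>
     (\<forall>x\<in>upper_half_space. (x $ 2) *\<^sub>R laplacian h x - \<alpha> *\<^sub>R partial 2 h x = 0)"

text \<open>
  The two separation relations, each being two equations. The functions \<open>g\<close> and \<open>\<Upsilon>\<close> are
  complex-valued because Bessel functions of imaginary argument occur in them.
\<close>

definition separation_relation_1 ::
    "real \<Rightarrow> real \<Rightarrow> (real \<Rightarrow> real \<Rightarrow> complex) \<Rightarrow> (real \<Rightarrow> real) \<Rightarrow> bool" where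
  "separation_relation_1 \<alpha> l g s \<longleftrightarrow>
     twice_differentiable_on s UNIV \<and>
     (\<forall>x2>0. twice_differentiable_on (\<lambda>t. g t x2) UNIV) \<and>
     (\<forall>x0. twice_differentiable_on (\<lambda>t. g x0 t) {0<..}) \<and>
     (\<forall>x0 x1 x2. x2 > 0 \<longrightarrow>
        - (D2 s x1 *\<^sub>R g x0 x2)
          = s x1 *\<^sub>R (D2 (\<lambda>t. g t x2) x0 + D2 (\<lambda>t. g x0 t) x2)
              - (\<alpha> * s x1 / x2) *\<^sub>R D1 (\<lambda>t. g x0 t) x2 \<and>
        s x1 *\<^sub>R (D2 (\<lambda>t. g t x2) x0 + D2 (\<lambda>t. g x0 t) x2)
              - (\<alpha> * s x1 / x2) *\<^sub>R D1 (\<lambda>t. g x0 t) x2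
          = (l\<^sup>2 * s x1) *\<^sub>R g x0 x2)"

definition separation_relation_2 ::
    "real \<Rightarrow> real \<Rightarrow> real \<Rightarrow> (real \<Rightarrow> real) \<Rightarrow> (real \<Rightarrow> complex) \<Rightarrow> bool" where
  "separation_relation_2 \<alpha> l \<beta> \<Xi> \<Upsilon> \<longleftrightarrow>
     twice_differentiable_on \<Xi> UNIV \<and>
     twice_differentiable_on \<Upsilon> {0<..} \<and>
     (\<forall>x0 x2. x2 > 0 \<longrightarrow>
        - (D2 \<Xi> x0 *\<^sub>R \<Upsilon> x2)
          = \<Xi> x0 *\<^sub>R D2 \<Upsilon> x2 - (\<alpha> * \<Xi> x0 / x2) *\<^sub>R D1 \<Upsilon> x2 - (l\<^sup>2 * \<Xi> x0) *\<^sub>R \<Upsilon> x2 \<and>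
        \<Xi> x0 *\<^sub>R D2 \<Upsilon> x2 - (\<alpha> * \<Xi> x0 / x2) *\<^sub>R D1 \<Upsilon> x2 - (l\<^sup>2 * \<Xi> x0) *\<^sub>R \<Upsilon> x2
          = - ((\<beta>\<^sup>2 * \<Xi> x0) *\<^sub>R \<Upsilon> x2))"

definition s_sol :: "(int \<Rightarrow> real) \<Rightarrow> (int \<Rightarrow> real) \<Rightarrow> int \<Rightarrow> real \<Rightarrow> real" where
  "s_sol C1 C2 l x1 = C1 l * cos (real_of_int l * x1) + C2 l * sin (real_of_int l * x1)"

definition Xi_sol :: "(real \<Rightarrow> real) \<Rightarrow> (real \<Rightarrow> real) \<Rightarrow> real \<Rightarrow> real \<Rightarrow> real" where
  "Xi_sol B1 B2 \<beta> x0 = B1 \<beta> * cosh (\<beta> * x0) + B2 \<beta> * sinh (\<beta> * x0)"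

text \<open>The case \<open>l\<^sup>2 = \<beta>\<^sup>2\<close>, which falls under \<open>else\<close>, does not occur for non-integer \<open>\<beta>\<close>.\<close>

definition Upsilon_sol ::
    "real \<Rightarrow> (int \<Rightarrow> real \<Rightarrow> real) \<Rightarrow> (int \<Rightarrow> real \<Rightarrow> real) \<Rightarrow> int \<Rightarrow> real \<Rightarrow> real \<Rightarrow> complex" where
  "Upsilon_sol \<alpha> A1 A2 l \<beta> x2 =
     (let \<nu> = complex_of_real ((\<alpha> + 1) / 2);
          z = (if (real_of_int l)\<^sup>2 < \<beta>\<^sup>2
               then complex_of_real (x2 * sqrt (\<beta>\<^sup>2 - (real_of_int l)\<^sup>2))
               else \<i> * complex_of_real (x2 * sqrt ((real_of_int l)\<^sup>2 - \<beta>\<^sup>2)))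
      in (x2 powr ((\<alpha> + 1) / 2)) *\<^sub>R (A1 l \<beta> *\<^sub>R bessel_J \<nu> z + A2 l \<beta> *\<^sub>R bessel_Y \<nu> z))"

definition g_sol ::
    "real \<Rightarrow> (int \<Rightarrow> real \<Rightarrow> real) \<Rightarrow> (int \<Rightarrow> real \<Rightarrow> real) \<Rightarrow> (real \<Rightarrow> real) \<Rightarrow> (real \<Rightarrow> real) \<Rightarrow>
     int \<Rightarrow> real \<Rightarrow> real \<Rightarrow> real \<Rightarrow> complex" where
  "g_sol \<alpha> A1 A2 B1 B2 l \<beta> x0 x2 = Xi_sol B1 B2 \<beta> x0 *\<^sub>R Upsilon_sol \<alpha> A1 A2 l \<beta> x2"

definition h_term ::
    "real \<Rightarrow> (int \<Rightarrow> real \<Rightarrow> real) \<Rightarrow> (int \<Rightarrow> real \<Rightarrow> real) \<Rightarrow> (real \<Rightarrow> real) \<Rightarrow> (real \<Rightarrow> real) \<Rightarrow>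
     (int \<Rightarrow> real) \<Rightarrow> (int \<Rightarrow> real) \<Rightarrow> real \<Rightarrow> int \<Rightarrow> real^3 \<Rightarrow> complex" where
  "h_term \<alpha> A1 A2 B1 B2 C1 C2 \<beta> l x =
     s_sol C1 C2 l (x $ 1) *\<^sub>R g_sol \<alpha> A1 A2 B1 B2 l \<beta> (x $ 0) (x $ 2)"

definition h_sol ::
    "real \<Rightarrow> (int \<Rightarrow> real \<Rightarrow> real) \<Rightarrow> (int \<Rightarrow> real \<Rightarrow> real) \<Rightarrow> (real \<Rightarrow> real) \<Rightarrow> (real \<Rightarrow> real) \<Rightarrow>
     (int \<Rightarrow> real) \<Rightarrow> (int \<Rightarrow> real) \<Rightarrow> real \<Rightarrow> real^3 \<Rightarrow> complex" where
  "h_sol \<alpha> A1 A2 B1 B2 C1 C2 \<beta> x = (\<Sum>\<^sub>\<infinity>l. h_term \<alpha> A1 A2 B1 B2 C1 C2 \<beta> l x)"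

end

theory Submission
  imports Defs "HOL-Complex_Analysis.Cauchy_Integral_Formula"
begin

text \<open>
  The factor \<open>\<Upsilon>\<close> solves \<open>\<Upsilon>'' = \<alpha>/x \<Upsilon>' + k \<Upsilon>\<close> with \<open>k = l\<^sup>2 - \<beta>\<^sup>2\<close>: up to powers, \<open>J\<close> is an entire
  function of \<open>x\<^sup>2\<close> whose coefficients obey a two-term recurrence, and for integer order \<open>Y\<close> is a
  combination of derivatives of \<open>J\<close> with respect to the order, so that its equation follows by
  differentiating the recurrence. This gives the separation relations.

  Pointwise summability alone allows the series to be differentiated twice term by term. A
  Denjoy--Lusin argument in \<open>x\<^sub>1\<close> removes the trigonometric factors, so the values of \<open>\<Upsilon>\<close>, weighted
  with the amplitudes, are summable over \<open>l\<close> at every \<open>x\<^sub>2\<close>. For \<open>k > 0\<close> the equation has a maximum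
  principle, and a quadratic barrier of size \<open>1/k\<close> improves it to a bound in the interior of an
  interval by \<open>O(1/k\<^sup>2)\<close> times the sum of the values at its endpoints. This controls all second
  derivatives locally uniformly.
\<close>

section \<open>The power series of the Bessel functions\<close>

text \<open>The obstacle is that the constants are arbitrary and the hypothesis gives convergence at
  each point only, with no uniformity and no rate. The estimates therefore use nothing about Bessel
  functions except their differential equation: they hold for all its solutions, with a constant
  that does not depend on \<open>k\<close>, and bound a solution and its derivatives near a height z
  by its values at the two heights z/4 and 15z/8. Summability at these two heights then yields a
  local majorant.

  The factor in \<open>x$0\<close> is the same for all \<open>l\<close>, so it is divided out at one
  point where it does not vanish. The maximum principle needs \<open>k > 0\<close>, and constants
  independent of \<open>k\<close> need \<open>k\<close> bounded away from 0. Only finitely many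
  \<open>l\<close> have \<open>k < 1\<close>, among them all with oscillating
  \<open>\<Upsilon>\<close>; for these, continuity on compact sets is enough.

  For integer order, \<open>bessel_Y\<close> is a limit in the order. This is why the power series
  is studied as a function of a complex order as well, and why \<open>rGamma\<close> rather than
  \<open>Gamma\<close> stands in its coefficients: they are then entire in the order.\<close>

definition bessel_coeff :: "complex \<Rightarrow> nat \<Rightarrow> complex" where
  "bessel_coeff \<mu> k = (-1) ^ k * rGamma (\<mu> + of_nat k + 1) / fact k"

definition bessel_coeff' :: "complex \<Rightarrow> nat \<Rightarrow> complex" where
  "bessel_coeff' \<mu> k = deriv (\<lambda>\<mu>. bessel_coeff \<mu> k) \<mu>"

text \<open>The Bessel function without its power: at w = (z/2)^2, multiplication by (z/2)^\<mu>
  gives J of order \<mu>. The primed versions are derivatives in the order \<mu>, not in w.\<close>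

definition bessel_series :: "complex \<Rightarrow> complex \<Rightarrow> complex" where
  "bessel_series \<mu> w = (\<Sum>k. bessel_coeff \<mu> k * w ^ k)"

definition bessel_series' :: "complex \<Rightarrow> complex \<Rightarrow> complex" where
  "bessel_series' \<mu> w = (\<Sum>k. bessel_coeff' \<mu> k * w ^ k)"

text \<open>The functional equation of the reciprocal Gamma function. It is kept free of division so
  that it also holds where \<mu> + k + 1 = 0.\<close>

lemma bessel_coeff_Suc:
  "of_nat (Suc k) * (\<mu> + of_nat k + 1) * bessel_coeff \<mu> (Suc k) = - bessel_coeff \<mu> k"
proof -
  have "(\<mu> + of_nat k + 1) * rGamma (\<mu> + of_nat (Suc k) + 1) = rGamma (\<mu> + of_nat k + 1)"
    using rGamma_plus1[of "\<mu> + of_nat k + 1"] by (simp add: algebra_simps)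
  thus ?thesis
    by (simp add: bessel_coeff_def divide_simps del: of_nat_Suc)
qed

lemma bessel_coeff_has_derivative:
  "((\<lambda>\<mu>. bessel_coeff \<mu> k) has_field_derivative bessel_coeff' \<mu> k) (at \<mu>)"
proof -
  have "(\<lambda>\<mu>. bessel_coeff \<mu> k) holomorphic_on UNIV"
    unfolding bessel_coeff_def by (intro holomorphic_intros) auto
  thus ?thesis
    unfolding bessel_coeff'_def by (auto intro!: holomorphic_derivI)
qed

lemma bessel_coeff'_Suc:
  "of_nat (Suc k) * (\<mu> + of_nat k + 1) * bessel_coeff' \<mu> (Suc k) + bessel_coeff' \<mu> k
     = - (of_nat (Suc k) * bessel_coeff \<mu> (Suc k))"
proof -
  have "((\<lambda>\<mu>. of_nat (Suc k) * (\<mu> + of_nat k + 1) * bessel_coeff \<mu> (Suc k) + bessel_coeff \<mu> k)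
          has_field_derivative
        of_nat (Suc k) * bessel_coeff \<mu> (Suc k)
          + of_nat (Suc k) * (\<mu> + of_nat k + 1) * bessel_coeff' \<mu> (Suc k) + bessel_coeff' \<mu> k) (at \<mu>)"
    by (auto intro!: derivative_eq_intros bessel_coeff_has_derivative simp: algebra_simps)
  moreover have "(\<lambda>\<mu>. of_nat (Suc k) * (\<mu> + of_nat k + 1) * bessel_coeff \<mu> (Suc k) + bessel_coeff \<mu> k)
      = (\<lambda>_. 0)"
    by (rule ext) (simp only: bessel_coeff_Suc, simp)
  ultimately have "of_nat (Suc k) * bessel_coeff \<mu> (Suc k)
          + of_nat (Suc k) * (\<mu> + of_nat k + 1) * bessel_coeff' \<mu> (Suc k) + bessel_coeff' \<mu> k = 0"
    by (metis DERIV_const DERIV_unique)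
  thus ?thesis by algebra
qed

text \<open>Beyond the index N the factor \<mu> + n + 1 in the recurrence has modulus at least 1 for
  all \<mu> in the ball, so each step gains a factor 1/(k + 1). The uniformity in \<mu> is what
  termwise differentiation in the order requires.\<close>

lemma bessel_coeff_bound:
  obtains A N where "\<And>\<mu> k. \<mu> \<in> cball \<mu>0 1 \<Longrightarrow> norm (bessel_coeff \<mu> (N + k)) \<le> A / fact k"
proof -
  obtain N :: nat where N: "norm \<mu>0 + 1 < real N"
    using reals_Archimedean2 by blast
  have "continuous_on (cball \<mu>0 1) (\<lambda>\<mu>. bessel_coeff \<mu> N)"
    by (rule DERIV_continuous_on, rule has_field_derivative_at_within, rule bessel_coeff_has_derivative)
  hence "bounded ((\<lambda>\<mu>. bessel_coeff \<mu> N) ` cball \<mu>0 1)"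
    by (intro compact_imp_bounded compact_continuous_image) auto
  then obtain A where A: "\<And>\<mu>. \<mu> \<in> cball \<mu>0 1 \<Longrightarrow> norm (bessel_coeff \<mu> N) \<le> A"
    unfolding bounded_iff by blast
  have "norm (bessel_coeff \<mu> (N + k)) \<le> A / fact k" if \<mu>: "\<mu> \<in> cball \<mu>0 1" for \<mu> k
  proof (induction k)
    case 0
    thus ?case using A[OF \<mu>] by simp
  next
    case (Suc k)
    let ?n = "N + k"
    have "norm \<mu> \<le> norm \<mu>0 + 1"
      using \<mu> norm_triangle_ineq2[of \<mu> \<mu>0] by (simp add: dist_norm norm_minus_commute)
    moreover have "real N \<le> real ?n" by simp
    ultimately have "1 \<le> real ?n + 1 - norm \<mu>"
      using N by linarith
    also have "\<dots> \<le> norm (\<mu> + of_nat ?n + 1)"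
      using norm_triangle_ineq2[of "of_nat ?n + 1" "- \<mu>"] norm_of_nat[of "Suc ?n", where ?'a = complex]
      by (simp add: algebra_simps)
    finally have 1: "1 \<le> norm (\<mu> + of_nat ?n + 1)" .
    have "norm (bessel_coeff \<mu> ?n)
        = real (Suc ?n) * norm (\<mu> + of_nat ?n + 1) * norm (bessel_coeff \<mu> (Suc ?n))"
      using arg_cong[OF bessel_coeff_Suc[of ?n \<mu>], of norm] by (simp only: norm_mult norm_of_nat norm_minus_cancel)
    also have "\<dots> \<ge> real (Suc k) * 1 * norm (bessel_coeff \<mu> (Suc ?n))"
      by (intro mult_mono 1) auto
    finally have "real (Suc k) * norm (bessel_coeff \<mu> (Suc ?n)) \<le> A / fact k"
      using Suc by simp
    hence "norm (bessel_coeff \<mu> (Suc ?n)) \<le> A / fact k / real (Suc k)"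
      by (simp add: pos_le_divide_eq mult.commute del: of_nat_Suc)
    thus ?case by (simp add: mult.commute del: of_nat_Suc)
  qed
  thus ?thesis using that by blast
qed

lemma bessel_series_has_derivative_order:
  shows "summable (\<lambda>k. bessel_coeff \<mu> k * w ^ k)"
    and "summable (\<lambda>k. bessel_coeff' \<mu> k * w ^ k)"
    and "((\<lambda>\<mu>. bessel_series \<mu> w) has_field_derivative bessel_series' \<mu> w) (at \<mu>)"
proof -
  obtain A N where A: "\<And>\<mu>' k. \<mu>' \<in> cball \<mu> 1 \<Longrightarrow> norm (bessel_coeff \<mu>' (N + k)) \<le> A / fact k"
    using bessel_coeff_bound by blast
  \<comment> \<open>For k < N the truncated difference only gives a filler value: the majorant is
    claimed from N on.\<close>
  define h where "h k = A / fact (k - N) * norm w ^ k" for k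
  have "summable (\<lambda>k. A * norm w ^ N * (norm w ^ k /\<^sub>R fact k))"
    by (intro summable_mult summable_exp_generic)
  hence "summable (\<lambda>k. h (k + N))"
    by (simp add: h_def power_add field_simps)
  hence h: "summable h" by simp
  have ev: "\<forall>\<^sub>F n in sequentially. \<forall>x\<in>ball \<mu> 1. norm (bessel_coeff x n * w ^ n) \<le> h n"
    using eventually_ge_at_top[of N]
  proof eventually_elim
    case (elim n)
    show ?case
    proof
      fix x assume "x \<in> ball \<mu> 1"
      hence "norm (bessel_coeff x (N + (n - N))) \<le> A / fact (n - N)"
        by (intro A) auto
      from mult_right_mono[OF this, of "norm w ^ n"]
      show "norm (bessel_coeff x n * w ^ n) \<le> h n"
        using elim by (simp add: h_def norm_mult norm_power)
    qed
  qed
  have d: "((\<lambda>\<mu>. bessel_coeff \<mu> n * w ^ n) has_field_derivative bessel_coeff' x n * w ^ n) (at x)" for n x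
    by (intro DERIV_cmult_right bessel_coeff_has_derivative)
  obtain g g' where g: "\<forall>x\<in>ball \<mu> 1. (\<lambda>n. bessel_coeff x n * w ^ n) sums g x \<and>
      (\<lambda>n. bessel_coeff' x n * w ^ n) sums g' x \<and> (g has_field_derivative g' x) (at x)"
    by (rule series_and_derivative_comparison[OF open_ball h d ev])
  have g\<mu>: "(\<lambda>n. bessel_coeff \<mu> n * w ^ n) sums g \<mu>" "(\<lambda>n. bessel_coeff' \<mu> n * w ^ n) sums g' \<mu>"
      "(g has_field_derivative g' \<mu>) (at \<mu>)"
    using g by auto
  show "summable (\<lambda>k. bessel_coeff \<mu> k * w ^ k)" "summable (\<lambda>k. bessel_coeff' \<mu> k * w ^ k)"
    using g\<mu>(1,2) by (auto simp: sums_iff)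
  have "bessel_series' \<mu> w = g' \<mu>"
    using g\<mu>(2) by (simp add: bessel_series'_def sums_iff)
  moreover have "((\<lambda>\<mu>. bessel_series \<mu> w) has_field_derivative g' \<mu>) (at \<mu>)"
    using g\<mu>(3) by (rule has_field_derivative_transform_within_open[OF _ open_ball[of \<mu> 1]])
      (use g in \<open>auto simp: bessel_series_def sums_iff\<close>)
  ultimately show "((\<lambda>\<mu>. bessel_series \<mu> w) has_field_derivative bessel_series' \<mu> w) (at \<mu>)"
    by simp
qed

text \<open>The right-hand side \<open>d\<close> allows one proof for two series: it is zero for the
  Bessel series, and for the derivative in the order it comes from differentiating the factor \<mu>
  in the recurrence.\<close>

lemma power_series_bessel_ode:
  fixes c d :: "nat \<Rightarrow> complex"
  assumes c: "\<And>w. summable (\<lambda>k. c k * w ^ k)"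
    and rec: "\<And>k. of_nat (Suc k) * (\<mu> + of_nat k + 1) * c (Suc k) + c k = - d k"
  obtains P1 P2 where
    "\<And>w. ((\<lambda>w. \<Sum>k. c k * w ^ k) has_field_derivative P1 w) (at w)"
    "\<And>w. P1 w = (\<Sum>k. of_nat (Suc k) * c (Suc k) * w ^ k)"
    "\<And>w. (P1 has_field_derivative P2 w) (at w)"
    "\<And>w. w * P2 w + (\<mu> + 1) * P1 w + (\<Sum>k. c k * w ^ k) = - (\<Sum>k. d k * w ^ k)"
proof -
  define P1 where "P1 w = (\<Sum>k. diffs c k * w ^ k)" for w
  define P2 where "P2 w = (\<Sum>k. diffs (diffs c) k * w ^ k)" for w
  have s1: "summable (\<lambda>k. diffs c k * w ^ k)" for w
    by (rule termdiff_converges_all[OF c])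
  have s2: "summable (\<lambda>k. diffs (diffs c) k * w ^ k)" for w
    by (rule termdiff_converges_all[OF s1])
  show ?thesis
  proof
    fix w
    show "((\<lambda>w. \<Sum>k. c k * w ^ k) has_field_derivative P1 w) (at w)"
      unfolding P1_def by (rule termdiffs_strong_converges_everywhere[OF c])
    show "P1 w = (\<Sum>k. of_nat (Suc k) * c (Suc k) * w ^ k)"
      by (simp add: P1_def diffs_def)
    show "(P1 has_field_derivative P2 w) (at w)"
      unfolding P1_def[abs_def] P2_def by (rule termdiffs_strong_converges_everywhere[OF s1])
    have "(\<lambda>k. of_nat k * diffs c k * w ^ k) sums (w * P2 w)"
    proof -
      have "(\<lambda>k. w * (diffs (diffs c) k * w ^ k)) sums (w * P2 w)"
        unfolding P2_def by (intro sums_mult summable_sums s2)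
      hence "(\<lambda>k. of_nat (Suc k) * diffs c (Suc k) * w ^ Suc k) sums (w * P2 w)"
        by (simp add: diffs_def mult_ac)
      thus ?thesis by (subst (asm) sums_Suc_iff) simp
    qed
    moreover have "(\<lambda>k. diffs c k * w ^ k) sums P1 w"
      unfolding P1_def by (intro summable_sums s1)
    moreover have "(\<lambda>k. c k * w ^ k) sums (\<Sum>k. c k * w ^ k)"
      by (intro summable_sums c)
    ultimately have "(\<lambda>k. of_nat k * diffs c k * w ^ k + (\<mu> + 1) * (diffs c k * w ^ k) + c k * w ^ k)
        sums (w * P2 w + (\<mu> + 1) * P1 w + (\<Sum>k. c k * w ^ k))"
      by (intro sums_add sums_mult)
    moreover have "of_nat k * diffs c k * w ^ k + (\<mu> + 1) * (diffs c k * w ^ k) + c k * w ^ k = - (d k * w ^ k)" for k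
    proof -
      have "of_nat k * diffs c k * w ^ k + (\<mu> + 1) * (diffs c k * w ^ k) + c k * w ^ k
          = (of_nat (Suc k) * (\<mu> + of_nat k + 1) * c (Suc k) + c k) * w ^ k"
        by (simp add: diffs_def algebra_simps)
      thus ?thesis by (simp only: rec) simp
    qed
    ultimately have *: "(\<lambda>k. - (d k * w ^ k)) sums (w * P2 w + (\<mu> + 1) * P1 w + (\<Sum>k. c k * w ^ k))"
      by simp
    from sums_minus[OF this] have "(\<lambda>k. d k * w ^ k) sums - (w * P2 w + (\<mu> + 1) * P1 w + (\<Sum>k. c k * w ^ k))"
      by simp
    thus "w * P2 w + (\<mu> + 1) * P1 w + (\<Sum>k. c k * w ^ k) = - (\<Sum>k. d k * w ^ k)"
      by (simp add: sums_iff)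
  qed
qed

text \<open>The last equation is formally the derivative of the third in \<mu>; the term
  \<open>- G1 w\<close> stems from the coefficient \<mu> + 1.\<close>

lemma bessel_series_ode:
  obtains G1 G2 H1 H2 where
    "\<And>w. (bessel_series \<mu> has_field_derivative G1 w) (at w)"
    "\<And>w. (G1 has_field_derivative G2 w) (at w)"
    "\<And>w. w * G2 w + (\<mu> + 1) * G1 w + bessel_series \<mu> w = 0"
    "\<And>w. (bessel_series' \<mu> has_field_derivative H1 w) (at w)"
    "\<And>w. (H1 has_field_derivative H2 w) (at w)"
    "\<And>w. w * H2 w + (\<mu> + 1) * H1 w + bessel_series' \<mu> w = - G1 w"
proof -
  have G: "of_nat (Suc k) * (\<mu> + of_nat k + 1) * bessel_coeff \<mu> (Suc k) + bessel_coeff \<mu> k = - 0" for k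
    by (simp only: bessel_coeff_Suc) simp
  obtain G1 G2 where G: "\<And>w. (bessel_series \<mu> has_field_derivative G1 w) (at w)"
    "\<And>w. G1 w = (\<Sum>k. of_nat (Suc k) * bessel_coeff \<mu> (Suc k) * w ^ k)"
    "\<And>w. (G1 has_field_derivative G2 w) (at w)"
    "\<And>w. w * G2 w + (\<mu> + 1) * G1 w + bessel_series \<mu> w = - (\<Sum>k. 0 * w ^ k)"
    by (rule power_series_bessel_ode[OF bessel_series_has_derivative_order(1) G, folded bessel_series_def])
      (rule that, assumption+)
  obtain H1 H2 where H: "\<And>w. (bessel_series' \<mu> has_field_derivative H1 w) (at w)"
    "\<And>w. (H1 has_field_derivative H2 w) (at w)"
    "\<And>w. w * H2 w + (\<mu> + 1) * H1 w + bessel_series' \<mu> w = - G1 w"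
    by (rule power_series_bessel_ode[OF bessel_series_has_derivative_order(2) bessel_coeff'_Suc,
          folded bessel_series'_def]) (rule that, assumption, assumption, simp only: G(2))
  have G4: "w * G2 w + (\<mu> + 1) * G1 w + bessel_series \<mu> w = 0" for w
    using G(4)[of w] by simp
  show ?thesis by (rule that[OF G(1,3) G4 H])
qed

section \<open>Bessel functions in the order and the argument\<close>

definition weinstein_ode :: "real \<Rightarrow> real \<Rightarrow> (real \<Rightarrow> complex) \<Rightarrow> (real \<Rightarrow> complex) \<Rightarrow> bool" where
  "weinstein_ode \<alpha> k u u1 \<longleftrightarrow>
     (\<forall>x>0. (u has_vector_derivative u1 x) (at x) \<and>
            (u1 has_vector_derivative (\<alpha> / x) *\<^sub>R u1 x + k *\<^sub>R u x) (at x))"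

lemma weinstein_ode_lincomb:
  assumes "weinstein_ode \<alpha> k u u1" "weinstein_ode \<alpha> k v v1"
  shows "weinstein_ode \<alpha> k (\<lambda>x. a * u x + b * v x) (\<lambda>x. a * u1 x + b * v1 x)"
  unfolding weinstein_ode_def
proof (intro allI impI conjI)
  fix x :: real assume "x > 0"
  hence u: "(u has_vector_derivative u1 x) (at x)" "(v has_vector_derivative v1 x) (at x)"
      "(u1 has_vector_derivative (\<alpha> / x) *\<^sub>R u1 x + k *\<^sub>R u x) (at x)"
      "(v1 has_vector_derivative (\<alpha> / x) *\<^sub>R v1 x + k *\<^sub>R v x) (at x)"
    using assms by (simp_all add: weinstein_ode_def)
  show "((\<lambda>x. a * u x + b * v x) has_vector_derivative a * u1 x + b * v1 x) (at x)"
    by (intro has_vector_derivative_add has_vector_derivative_mult_right u)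
  have "((\<lambda>x. a * u1 x + b * v1 x) has_vector_derivative
      a * ((\<alpha> / x) *\<^sub>R u1 x + k *\<^sub>R u x) + b * ((\<alpha> / x) *\<^sub>R v1 x + k *\<^sub>R v x)) (at x)"
    by (intro has_vector_derivative_add has_vector_derivative_mult_right u)
  moreover have "a * ((\<alpha> / x) *\<^sub>R u1 x + k *\<^sub>R u x) + b * ((\<alpha> / x) *\<^sub>R v1 x + k *\<^sub>R v x)
      = (\<alpha> / x) *\<^sub>R (a * u1 x + b * v1 x) + k *\<^sub>R (a * u x + b * v x)"
    by (simp add: distrib_left scaleR_add_right)
  ultimately show "((\<lambda>x. a * u1 x + b * v1 x) has_vector_derivative
      (\<alpha> / x) *\<^sub>R (a * u1 x + b * v1 x) + k *\<^sub>R (a * u x + b * v x)) (at x)"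
    by simp
qed

text \<open>The substitution \<open>x = exp t\<close> leaves \<open>exp t ^ 2\<close> as the only variable coefficient.\<close>

lemma weinstein_ode_exp:
  fixes v v1 v2 :: "complex \<Rightarrow> complex"
  assumes v: "\<And>t. (v has_field_derivative v1 t) (at t)" "\<And>t. (v1 has_field_derivative v2 t) (at t)"
    and eq: "\<And>t. v2 t - complex_of_real (\<alpha> + 1) * v1 t = k * exp t ^ 2 * v t"
    and u: "\<And>x. x > 0 \<Longrightarrow> u x = v (complex_of_real (ln x))"
  shows "weinstein_ode \<alpha> k u (\<lambda>x. v1 (complex_of_real (ln x)) / x)"
  unfolding weinstein_ode_def
proof (intro allI impI conjI)
  fix x :: real assume x: "x > 0"
  have ln: "((\<lambda>x. complex_of_real (ln x)) has_vector_derivative complex_of_real (1 / x)) (at x)"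
    by (rule has_vector_derivative_of_real) (use x in \<open>simp add: DERIV_ln_divide\<close>)
  have exp_ln: "exp (complex_of_real (ln x)) = x"
    using exp_of_real[of "ln x", where 'a = complex] x by simp
  have "((\<lambda>x. v (complex_of_real (ln x))) has_vector_derivative complex_of_real (1 / x) * v1 (complex_of_real (ln x))) (at x)"
    using field_vector_diff_chain_at[OF ln v(1)] by (simp add: o_def)
  thus "(u has_vector_derivative v1 (complex_of_real (ln x)) / x) (at x)"
    by (intro has_vector_derivative_transform_within_open[where S = "{0<..}" and g = u])
       (use x u in \<open>auto simp: scaleR_conv_of_real\<close>)
  have d2: "((\<lambda>x. v1 (complex_of_real (ln x))) has_vector_derivative complex_of_real (1 / x) * v2 (complex_of_real (ln x))) (at x)"
    using field_vector_diff_chain_at[OF ln v(2)] by (simp add: o_def)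
  have "((\<lambda>x. (1 / x) *\<^sub>R v1 (complex_of_real (ln x))) has_vector_derivative
      (1 / x) *\<^sub>R (complex_of_real (1 / x) * v2 (complex_of_real (ln x))) - (1 / x\<^sup>2) *\<^sub>R v1 (complex_of_real (ln x))) (at x)"
  proof -
    have "((\<lambda>x. 1 / x) has_real_derivative - (1 / x\<^sup>2)) (at x)"
      using x by (auto intro!: derivative_eq_intros simp: power2_eq_square)
    from has_vector_derivative_scaleR[OF this d2] show ?thesis by simp
  qed
  \<comment> \<open>In t = ln x one has x u' = v1 and x^2 u'' = v2 - v1; the extra v1 turns \<alpha>
    into \<alpha> + 1.\<close>
  moreover have "(1 / x) *\<^sub>R (complex_of_real (1 / x) * v2 (complex_of_real (ln x))) - (1 / x\<^sup>2) *\<^sub>R v1 (complex_of_real (ln x))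
      = (\<alpha> / x) *\<^sub>R (v1 (complex_of_real (ln x)) / x) + k *\<^sub>R u x"
  proof -
    have "v2 (complex_of_real (ln x)) = (\<alpha> + 1) * v1 (complex_of_real (ln x)) + k * complex_of_real x ^ 2 * v (complex_of_real (ln x))"
      using eq[of "ln x"] by (simp add: exp_ln algebra_simps)
    thus ?thesis
      using x by (simp add: u scaleR_conv_of_real field_simps power2_eq_square)
  qed
  ultimately show "((\<lambda>x. v1 (complex_of_real (ln x)) / x) has_vector_derivative (\<alpha> / x) *\<^sub>R (v1 (complex_of_real (ln x)) / x) + k *\<^sub>R u x) (at x)"
    by (simp add: scaleR_conv_of_real)
qed

lemma bessel_J_eq:
  "z \<noteq> 0 \<Longrightarrow> bessel_J \<mu> z = exp (\<mu> * Ln (z / 2)) * bessel_series \<mu> ((z / 2)\<^sup>2)"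
  by (simp add: bessel_J_def bessel_series_def bessel_coeff_def powr_def power_mult)

text \<open>The derivative of J in its order, at fixed argument; the logarithm comes from
  differentiating the power.\<close>

definition bessel_J' :: "complex \<Rightarrow> complex \<Rightarrow> complex" where
  "bessel_J' \<mu> z = exp (\<mu> * Ln (z / 2)) *
     (Ln (z / 2) * bessel_series \<mu> ((z / 2)\<^sup>2) + bessel_series' \<mu> ((z / 2)\<^sup>2))"

lemma bessel_J_has_derivative_order:
  assumes "z \<noteq> 0"
  shows "((\<lambda>\<mu>. bessel_J \<mu> z) has_field_derivative bessel_J' \<mu> z) (at \<mu>)"
  unfolding bessel_J_eq[OF assms] bessel_J'_def
  by (auto intro!: derivative_eq_intros bessel_series_has_derivative_order(3) simp: algebra_simps)

lemma rGamma_of_nat_plus1: "rGamma (of_nat n + 1 :: complex) = 1 / fact n"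
  using Gamma_fact[of n, where 'a = complex] by (simp add: rGamma_inverse_Gamma field_simps)

text \<open>At order -m the first m coefficients vanish, because the reciprocal Gamma function is
  zero at the nonpositive integers; shifting the index by m recovers the series of order m.\<close>

lemma bessel_series_minus_of_nat:
  "bessel_series (- of_nat m) w = (-1) ^ m * w ^ m * bessel_series (of_nat m) w"
proof -
  have 0: "bessel_coeff (- of_nat m) k = 0" if "k < m" for k
  proof -
    have "- of_nat m + of_nat k + 1 = - complex_of_nat (m - Suc k)"
      using that by (simp add: of_nat_diff)
    thus ?thesis
      by (simp add: bessel_coeff_def rGamma_eq_zero_iff)
  qed
  have shift: "bessel_coeff (- of_nat m) (k + m) = (-1) ^ m * bessel_coeff (of_nat m) k" for k
  proof -
    have "- complex_of_nat m + of_nat (k + m) + 1 = of_nat k + 1"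
         "complex_of_nat m + of_nat k + 1 = of_nat (k + m) + 1" by simp_all
    thus ?thesis
      by (simp only: bessel_coeff_def rGamma_of_nat_plus1) (simp add: power_add mult_ac)
  qed
  have "bessel_series (- of_nat m) w
      = (\<Sum>k. bessel_coeff (- of_nat m) (k + m) * w ^ (k + m)) + (\<Sum>k<m. bessel_coeff (- of_nat m) k * w ^ k)"
    unfolding bessel_series_def
    by (rule suminf_split_initial_segment[OF bessel_series_has_derivative_order(1)])
  also have "(\<Sum>k<m. bessel_coeff (- of_nat m) k * w ^ k) = 0"
    by (simp add: 0)
  also have "(\<lambda>k. bessel_coeff (- of_nat m) (k + m) * w ^ (k + m))
      = (\<lambda>k. ((-1) ^ m * w ^ m) * (bessel_coeff (of_nat m) k * w ^ k))"
    by (rule ext, simp only: shift power_add) (simp add: mult_ac)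
  also have "(\<Sum>k. ((-1) ^ m * w ^ m) * (bessel_coeff (of_nat m) k * w ^ k))
      = (-1) ^ m * w ^ m * bessel_series (of_nat m) w"
    unfolding bessel_series_def by (rule suminf_mult[OF bessel_series_has_derivative_order(1)])
  finally show ?thesis by simp
qed

lemma cos_pi_of_int: "cos (complex_of_real pi * of_int n) = (-1) powi n"
proof -
  have "cos (complex_of_real pi * of_int n) = of_real (cos (pi * real_of_int n))"
    by (metis cos_of_real of_real_mult of_real_of_int_eq)
  also have "cos (pi * real_of_int n) = (if even n then 1 else -1)"
    by (simp add: cos_npi_int mult.commute)
  finally have *: "cos (complex_of_real pi * of_int n) = of_real (if even n then 1 else - 1)" .
  show ?thesis
    unfolding * by (simp add: power_int_minus_left)
qed

lemma sin_pi_of_int: "sin (complex_of_real pi * of_int n) = 0"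
proof -
  have "sin (complex_of_real pi * of_int n) = of_real (sin (pi * real_of_int n))"
    by (metis sin_of_real of_real_mult of_real_of_int_eq)
  also have "sin (pi * real_of_int n) = 0"
    by (simp add: sin_npi_int mult.commute)
  finally show ?thesis by (simp only: of_real_0)
qed

text \<open>This is J of order -n equal to (-1)^n times J of order n, stated for an arbitrary
  logarithm L of z/2. The freedom matters: below it is applied with L = Ln (c/2) + t for complex t,
  which need not be a principal value.\<close>

lemma bessel_series_minus_of_int:
  assumes "\<nu> \<in> \<int>"
  shows "exp (- \<nu> * L) * bessel_series (- \<nu>) (exp L ^ 2)
    = cos (of_real pi * \<nu>) * (exp (\<nu> * L) * bessel_series \<nu> (exp L ^ 2))"
proof -
  define E where "E \<nu> = exp (\<nu> * L) * bessel_series \<nu> (exp L ^ 2)" for \<nu>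
  have nat: "E (- of_nat m) = (-1) ^ m * E (of_nat m)" for m
  proof -
    have "(exp L ^ 2) ^ m = exp (of_nat m * L) * exp (of_nat m * L)"
      by (simp only: exp_of_nat_mult power2_eq_square power_mult_distrib)
    hence *: "exp (of_nat m * L) = exp (- of_nat m * L) * (exp L ^ 2) ^ m"
      by (simp only: mult.assoc[symmetric] exp_add[symmetric]) (simp add: mult.commute)
    show ?thesis
      unfolding E_def bessel_series_minus_of_nat * by (simp only: mult_ac)
  qed
  obtain n where n: "\<nu> = of_int n" using assms by (rule Ints_cases)
  have "E (- \<nu>) = (-1) powi n * E \<nu>"
  proof (cases n rule: int_cases2)
    case (nonneg m)
    thus ?thesis using nat[of m] n by simp
  next
    case (nonpos m)
    have "(-1 :: complex) ^ m * (-1) ^ m = 1"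
      by (simp flip: power_mult_distrib)
    hence "E (of_nat m) = (-1) ^ m * E (- of_nat m)"
      by (simp only: nat mult.assoc[symmetric]) simp
    thus ?thesis using nonpos n by (simp add: power_int_minus flip: power_inverse)
  qed
  thus ?thesis
    unfolding n cos_pi_of_int E_def by simp
qed

lemma bessel_J_minus_of_int:
  assumes "z \<noteq> 0" "\<nu> \<in> \<int>"
  shows "bessel_J (- \<nu>) z = cos (of_real pi * \<nu>) * bessel_J \<nu> z"
  using bessel_series_minus_of_int[OF assms(2), of "Ln (z / 2)"] assms(1) by (simp add: bessel_J_eq)

text \<open>The rule of l'Hopital in the order: numerator and denominator both vanish at the integer
  \<nu>. The two order derivatives appear with a plus sign because the second one is taken along
  -\<mu>.\<close>

lemma bessel_Y_int:
  assumes "z \<noteq> 0" "\<nu> \<in> \<int>"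
  shows "bessel_Y \<nu> z = (bessel_J' \<nu> z + cos (of_real pi * \<nu>) * bessel_J' (- \<nu>) z) / of_real pi"
proof -
  define C where "C = cos (of_real pi * \<nu>)"
  obtain n where n: "\<nu> = of_int n" using assms(2) by (rule Ints_cases)
  have sin: "sin (of_real pi * \<nu>) = 0"
    by (simp add: n sin_pi_of_int)
  have C2: "C * C = 1"
    using sin_cos_squared_add[of "of_real pi * \<nu>"] by (simp add: C_def sin power2_eq_square)
  define N where "N \<mu> = bessel_J \<mu> z * cos (of_real pi * \<mu>) - bessel_J (- \<mu>) z" for \<mu>
  have N0: "N \<nu> = 0"
    by (simp add: N_def bessel_J_minus_of_int[OF assms])
  have "((\<lambda>\<mu>. bessel_J (- \<mu>) z) has_field_derivative bessel_J' (- \<nu>) z * - 1) (at \<nu>)"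
    by (rule DERIV_chain2[OF bessel_J_has_derivative_order[OF assms(1)]])
       (rule derivative_eq_intros refl)+
  moreover have "((\<lambda>\<mu>. cos (of_real pi * \<mu>)) has_field_derivative 0) (at \<nu>)"
    by (rule derivative_eq_intros refl)+ (simp add: sin)
  ultimately have "(N has_field_derivative
      bessel_J' \<nu> z * C + 0 * bessel_J \<nu> z - bessel_J' (- \<nu>) z * - 1) (at \<nu>)"
    unfolding N_def C_def
    by (intro DERIV_diff DERIV_mult bessel_J_has_derivative_order[OF assms(1)])
  hence "(N has_field_derivative bessel_J' \<nu> z * C + bessel_J' (- \<nu>) z) (at \<nu>)"
    by simp
  moreover have "((\<lambda>\<mu>. sin (of_real pi * \<mu>)) has_field_derivative of_real pi * C) (at \<nu>)"
    unfolding C_def by (rule derivative_eq_intros refl)+ simp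
  \<comment> \<open>The quotient is written as a quotient of two difference quotients; the
    derivative of the sine is \<pi> C, nonzero since C^2 = 1.\<close>
  ultimately have "((\<lambda>\<mu>. ((N \<mu> - N \<nu>) / (\<mu> - \<nu>)) /
      ((sin (of_real pi * \<mu>) - sin (of_real pi * \<nu>)) / (\<mu> - \<nu>))) \<longlongrightarrow>
      (bessel_J' \<nu> z * C + bessel_J' (- \<nu>) z) / (of_real pi * C)) (at \<nu>)"
    using C2 unfolding has_field_derivative_iff by (intro tendsto_divide) auto
  hence "((\<lambda>\<mu>. N \<mu> / sin (of_real pi * \<mu>)) \<longlongrightarrow>
      (bessel_J' \<nu> z * C + bessel_J' (- \<nu>) z) / (of_real pi * C)) (at \<nu>)"
    by (rule Lim_transform_eventually)
       (rule eventually_mono[OF eventually_neq_at_within[of \<nu>]], simp add: N0 sin)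
  hence "Lim (at \<nu>) (\<lambda>\<mu>. N \<mu> / sin (of_real pi * \<mu>)) =
      (bessel_J' \<nu> z * C + bessel_J' (- \<nu>) z) / (of_real pi * C)"
    by (intro tendsto_Lim) auto
  also have "\<dots> = (bessel_J' \<nu> z + C * bessel_J' (- \<nu>) z) / of_real pi"
  proof -
    have "C \<noteq> 0" using C2 by auto
    have "bessel_J' \<nu> z * C + bessel_J' (- \<nu>) z = (bessel_J' \<nu> z + C * bessel_J' (- \<nu>) z) * C"
      using C2 by algebra
    thus ?thesis using \<open>C \<noteq> 0\<close> by (simp add: field_simps)
  qed
  finally show ?thesis
    using assms(2) by (simp add: bessel_Y_def N_def C_def)
qed

text \<open>In the variable t = ln x, the term \<nu> t in the exponent is the prefactor x^\<nu>, and
  \<mu> (l + t) is the power in J, with l = Ln (c/2) and q = c^2/4. The function \<open>V\<close> is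
  the derivative of \<open>v\<close> in \<mu> at fixed \<nu>. For general \<mu> the first equation
  has an additional (\<mu>^2 - \<nu>^2) v on the right; its derivative in \<mu> explains the term 2
  \<mu> v in the second equation.\<close>

lemma bessel_series_exp:
  fixes \<nu> \<mu> q l :: complex
  assumes \<mu>: "\<mu>\<^sup>2 = \<nu>\<^sup>2"
  defines "E \<equiv> (\<lambda>t. exp (\<nu> * t + \<mu> * (l + t)))" and "w \<equiv> (\<lambda>t. q * exp t ^ 2)"
  defines "v \<equiv> (\<lambda>t. E t * bessel_series \<mu> (w t))"
    and "V \<equiv> (\<lambda>t. E t * ((l + t) * bessel_series \<mu> (w t) + bessel_series' \<mu> (w t)))"
  shows "\<exists>v1 v2. \<forall>t. (v has_field_derivative v1 t) (at t) \<and> (v1 has_field_derivative v2 t) (at t) \<and>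
           v2 t - 2 * \<nu> * v1 t = - 4 * w t * v t" (is ?th1)
    and "\<exists>V1 V2. \<forall>t. (V has_field_derivative V1 t) (at t) \<and> (V1 has_field_derivative V2 t) (at t) \<and>
           V2 t - 2 * \<nu> * V1 t = - 4 * w t * V t + 2 * \<mu> * v t" (is ?th2)
proof -
  obtain G1 G2 H1 H2 where
    G: "\<And>w. (bessel_series \<mu> has_field_derivative G1 w) (at w)"
       "\<And>w. (G1 has_field_derivative G2 w) (at w)"
       "\<And>w. w * G2 w + (\<mu> + 1) * G1 w + bessel_series \<mu> w = 0"
    and H: "\<And>w. (bessel_series' \<mu> has_field_derivative H1 w) (at w)"
       "\<And>w. (H1 has_field_derivative H2 w) (at w)"
       "\<And>w. w * H2 w + (\<mu> + 1) * H1 w + bessel_series' \<mu> w = - G1 w"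
    by (rule bessel_series_ode[of \<mu>]) (rule that, assumption+)
  let ?p = "\<nu> + \<mu>"
  have dE: "(E has_field_derivative ?p * E t) (at t)" for t
    unfolding E_def by (auto intro!: derivative_eq_intros simp: algebra_simps)
  have dw: "(w has_field_derivative 2 * w t) (at t)" for t
    unfolding w_def by (auto intro!: derivative_eq_intros simp: algebra_simps power2_eq_square)
  note d = dE dw DERIV_chain2[OF G(1) dw] DERIV_chain2[OF G(2) dw] DERIV_chain2[OF H(1) dw] DERIV_chain2[OF H(2) dw]
  define v1 where "v1 t = E t * (?p * bessel_series \<mu> (w t) + 2 * w t * G1 (w t))" for t
  define v2 where "v2 t = E t * (?p\<^sup>2 * bessel_series \<mu> (w t) + 2 * ?p * (2 * w t * G1 (w t))
    + 4 * w t * G1 (w t) + 4 * (w t)\<^sup>2 * G2 (w t))" for t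
  have v1: "(v has_field_derivative v1 t) (at t)" for t
    unfolding v_def v1_def by (rule derivative_eq_intros d refl)+ (simp add: algebra_simps)
  have v2: "(v1 has_field_derivative v2 t) (at t)" for t
    unfolding v1_def v2_def
    by (rule derivative_eq_intros d refl)+ (simp add: algebra_simps power2_eq_square)
  have v3: "v2 t - 2 * \<nu> * v1 t = - 4 * w t * v t" for t
    unfolding v1_def v2_def v_def using G(3)[of "w t"] \<mu> by algebra
  show ?th1
    using v1 v2 v3 by blast
  define W where "W t = E t * bessel_series' \<mu> (w t)" for t
  define W1 where "W1 t = E t * (?p * bessel_series' \<mu> (w t) + 2 * w t * H1 (w t))" for t
  define W2 where "W2 t = E t * (?p\<^sup>2 * bessel_series' \<mu> (w t) + 2 * ?p * (2 * w t * H1 (w t))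
    + 4 * w t * H1 (w t) + 4 * (w t)\<^sup>2 * H2 (w t))" for t
  have W1: "(W has_field_derivative W1 t) (at t)" for t
    unfolding W_def W1_def by (rule derivative_eq_intros d refl)+ (simp add: algebra_simps)
  have W2: "(W1 has_field_derivative W2 t) (at t)" for t
    unfolding W1_def W2_def
    by (rule derivative_eq_intros d refl)+ (simp add: algebra_simps power2_eq_square)
  have W3: "W2 t - 2 * \<nu> * W1 t = - 4 * w t * W t - 4 * w t * E t * G1 (w t)" for t
    unfolding W1_def W2_def W_def using H(3)[of "w t"] \<mu> by algebra
  have V: "V = (\<lambda>t. (l + t) * v t + W t)"
    by (simp add: V_def v_def W_def algebra_simps)
  have V1: "(V has_field_derivative v t + (l + t) * v1 t + W1 t) (at t)" for t
    unfolding V by (rule derivative_eq_intros v1 W1 refl)+ (simp add: algebra_simps)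
  have V2: "((\<lambda>t. v t + (l + t) * v1 t + W1 t) has_field_derivative 2 * v1 t + (l + t) * v2 t + W2 t) (at t)" for t
    by (rule derivative_eq_intros v1 v2 W2 refl)+ (simp add: algebra_simps)
  \<comment> \<open>The product rule leaves 2 (v1 - \<nu> v), whose \<open>G1\<close> part cancels
    the inhomogeneous term in \<open>W3\<close>.\<close>
  have V3: "2 * v1 t + (l + t) * v2 t + W2 t - 2 * \<nu> * (v t + (l + t) * v1 t + W1 t) = - 4 * w t * V t + 2 * \<mu> * v t" for t
  proof -
    have "v1 t - \<nu> * v t = \<mu> * v t + 2 * w t * E t * G1 (w t)"
      by (simp add: v1_def v_def algebra_simps)
    with v3[of t] W3[of t] show ?thesis unfolding V by algebra
  qed
  show ?th2
    by (intro exI[of _ "\<lambda>t. v t + (l + t) * v1 t + W1 t"]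
        exI[of _ "\<lambda>t. 2 * v1 t + (l + t) * v2 t + W2 t"] allI conjI V1 V2 V3)
qed

context
  fixes \<alpha> k :: real and \<nu> c :: complex
  assumes \<nu>: "\<nu> = complex_of_real ((\<alpha> + 1) / 2)" and c: "c \<noteq> 0" and k: "complex_of_real k = - c\<^sup>2"
begin

lemma two_nu: "2 * \<nu> = complex_of_real (\<alpha> + 1)"
  by (simp add: \<nu>)

text \<open>The principal logarithm is additive here because the factor x is positive. As c may be
  any square root of -k, real and imaginary arguments are treated together.\<close>

lemma scaled_arg:
  assumes "x > 0"
  shows "Ln (c * complex_of_real x / 2) = Ln (c / 2) + complex_of_real (ln x)"
    and "(c * complex_of_real x / 2)\<^sup>2 = c\<^sup>2 / 4 * exp (complex_of_real (ln x)) ^ 2"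
    and "complex_of_real (x powr ((\<alpha> + 1) / 2)) = exp (\<nu> * complex_of_real (ln x))"
proof -
  have "Ln (complex_of_real x * (c / 2)) = complex_of_real (ln x) + Ln (c / 2)"
    using Ln_times_of_real[of x "c / 2"] assms c by (simp add: Ln_of_real)
  thus "Ln (c * complex_of_real x / 2) = Ln (c / 2) + complex_of_real (ln x)"
    by (simp add: mult_ac add_ac)
  have "exp (complex_of_real (ln x)) = x"
    using exp_of_real[of "ln x", where 'a = complex] assms by simp
  thus "(c * complex_of_real x / 2)\<^sup>2 = c\<^sup>2 / 4 * exp (complex_of_real (ln x)) ^ 2"
    by (simp add: power_mult_distrib power_divide)
  show "complex_of_real (x powr ((\<alpha> + 1) / 2)) = exp (\<nu> * complex_of_real (ln x))"
    using assms unfolding \<nu> by (simp add: powr_def flip: exp_of_real)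
qed

lemma weinstein_ode_bessel_J:
  assumes "\<mu>\<^sup>2 = \<nu>\<^sup>2"
  shows "\<exists>u1. weinstein_ode \<alpha> k (\<lambda>x. x powr ((\<alpha> + 1) / 2) * bessel_J \<mu> (c * complex_of_real x)) u1"
proof -
  let ?v = "\<lambda>t. exp (\<nu> * t + \<mu> * (Ln (c / 2) + t)) * bessel_series \<mu> (c\<^sup>2 / 4 * exp t ^ 2)"
  obtain v1 v2 where v: "\<And>t. (?v has_field_derivative v1 t) (at t)"
    "\<And>t. (v1 has_field_derivative v2 t) (at t)"
    "\<And>t. v2 t - 2 * \<nu> * v1 t = - 4 * (c\<^sup>2 / 4 * exp t ^ 2) * ?v t"
    using bessel_series_exp(1)[OF assms, of "Ln (c / 2)" "c\<^sup>2 / 4"] by metis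
  have "weinstein_ode \<alpha> k (\<lambda>x. x powr ((\<alpha> + 1) / 2) * bessel_J \<mu> (c * complex_of_real x)) (\<lambda>x. v1 (complex_of_real (ln x)) / x)"
  proof (rule weinstein_ode_exp[OF v(1,2)])
    show "v2 t - complex_of_real (\<alpha> + 1) * v1 t = complex_of_real k * exp t ^ 2 * ?v t" for t
      using v(3)[of t] unfolding two_nu k by simp
    show "x powr ((\<alpha> + 1) / 2) * bessel_J \<mu> (c * complex_of_real x) = ?v (complex_of_real (ln x))" if "x > 0" for x
      using that c by (simp add: bessel_J_eq scaled_arg exp_add mult.assoc del: of_real_divide)
  qed
  thus ?thesis by blast
qed

text \<open>For non-integer order this is linearity. For integer order each order derivative solves
  the equation only up to an inhomogeneous term, 2 \<nu> v for \<nu> and its negative counterpart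
  for -\<nu>; in the combination that forms Y the two cancel by the reflection formula for
  J.\<close>

lemma weinstein_ode_bessel_Y:
  "\<exists>u1. weinstein_ode \<alpha> k (\<lambda>x. x powr ((\<alpha> + 1) / 2) * bessel_Y \<nu> (c * complex_of_real x)) u1"
proof (cases "\<nu> \<in> \<int>")
  case False
  let ?C = "cos (of_real pi * \<nu>)" and ?S = "sin (of_real pi * \<nu>)"
  let ?J = "\<lambda>\<mu> x. x powr ((\<alpha> + 1) / 2) * bessel_J \<mu> (c * complex_of_real x)"
  obtain u1 where u1: "weinstein_ode \<alpha> k (?J \<nu>) u1"
    using weinstein_ode_bessel_J[of \<nu>] by auto
  obtain u2 where u2: "weinstein_ode \<alpha> k (?J (- \<nu>)) u2"
    using weinstein_ode_bessel_J[of "- \<nu>"] by auto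
  have "(\<lambda>x. x powr ((\<alpha> + 1) / 2) * bessel_Y \<nu> (c * complex_of_real x))
      = (\<lambda>x. ?C / ?S * ?J \<nu> x + - 1 / ?S * ?J (- \<nu>) x)"
    using False by (simp add: bessel_Y_def fun_eq_iff diff_divide_distrib algebra_simps)
  thus ?thesis
    using weinstein_ode_lincomb[OF u1 u2, of "?C / ?S" "- 1 / ?S"] by auto
next
  case True
  let ?C = "cos (of_real pi * \<nu>)"
  let ?l = "Ln (c / 2)" and ?w = "\<lambda>t. c\<^sup>2 / 4 * exp t ^ 2"
  define v where "v \<mu> t = exp (\<nu> * t + \<mu> * (?l + t)) * bessel_series \<mu> (?w t)" for \<mu> t
  define V where "V \<mu> t = exp (\<nu> * t + \<mu> * (?l + t)) *
    ((?l + t) * bessel_series \<mu> (?w t) + bessel_series' \<mu> (?w t))" for \<mu> t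
  obtain V1 V2 where V: "\<And>t. (V \<nu> has_field_derivative V1 t) (at t)"
    "\<And>t. (V1 has_field_derivative V2 t) (at t)"
    "\<And>t. V2 t - 2 * \<nu> * V1 t = - 4 * ?w t * V \<nu> t + 2 * \<nu> * v \<nu> t"
    using bessel_series_exp(2)[OF refl, of \<nu> "Ln (c / 2)" "c\<^sup>2 / 4"] unfolding V_def v_def by metis
  obtain W1 W2 where W: "\<And>t. (V (- \<nu>) has_field_derivative W1 t) (at t)"
    "\<And>t. (W1 has_field_derivative W2 t) (at t)"
    "\<And>t. W2 t - 2 * \<nu> * W1 t = - 4 * ?w t * V (- \<nu>) t + 2 * (- \<nu>) * v (- \<nu>) t"
    using bessel_series_exp(2)[OF power2_minus, of \<nu> "Ln (c / 2)" "c\<^sup>2 / 4"] unfolding V_def v_def by metis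
  have V': "V \<mu> (complex_of_real (ln x)) = x powr ((\<alpha> + 1) / 2) * bessel_J' \<mu> (c * complex_of_real x)" if "x > 0" for \<mu> and x :: real
    using that c by (simp add: V_def bessel_J'_def scaled_arg exp_add mult.assoc del: of_real_divide)
  have cos_sq: "?C * ?C = 1"
    using sin_cos_squared_add[of "of_real pi * \<nu>"] True
    by (auto elim!: Ints_cases simp: sin_pi_of_int power2_eq_square)
  have refl: "?C * v (- \<nu>) t = v \<nu> t" for t
  proof -
    have "?w t = exp (?l + t) ^ 2"
      using c by (simp add: exp_add power_mult_distrib power_divide)
    hence v': "v \<mu> t = exp (\<nu> * t) * (exp (\<mu> * (?l + t)) * bessel_series \<mu> (exp (?l + t) ^ 2))" for \<mu>
      unfolding v_def by (simp only: exp_add[of "\<nu> * t"] mult.assoc)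
    show ?thesis
      unfolding v' bessel_series_minus_of_int[OF True] using cos_sq by algebra
  qed
  let ?U = "\<lambda>t. (V \<nu> t + ?C * V (- \<nu>) t) / of_real pi"
  have "weinstein_ode \<alpha> k (\<lambda>x. x powr ((\<alpha> + 1) / 2) * bessel_Y \<nu> (c * complex_of_real x))
      (\<lambda>x. (V1 (complex_of_real (ln x)) + ?C * W1 (complex_of_real (ln x))) / of_real pi / x)"
  proof (rule weinstein_ode_exp[where v = ?U and ?v2.0 = "\<lambda>t. (V2 t + ?C * W2 t) / of_real pi"])
    fix t
    show "(?U has_field_derivative (V1 t + ?C * W1 t) / of_real pi) (at t)"
      "((\<lambda>t. (V1 t + ?C * W1 t) / of_real pi) has_field_derivative (V2 t + ?C * W2 t) / of_real pi) (at t)"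
      by (rule derivative_eq_intros V W refl | simp)+
    have "V2 t + ?C * W2 t - 2 * \<nu> * (V1 t + ?C * W1 t) = - 4 * ?w t * (V \<nu> t + ?C * V (- \<nu>) t)"
      using V(3)[of t] W(3)[of t] refl[of t] by algebra
    thus "(V2 t + ?C * W2 t) / of_real pi - complex_of_real (\<alpha> + 1) * ((V1 t + ?C * W1 t) / of_real pi)
        = complex_of_real k * exp t ^ 2 * ?U t"
      unfolding two_nu k by (simp add: divide_simps)
  next
    fix x :: real assume x: "x > 0"
    have "c * complex_of_real x \<noteq> 0" using x c by simp
    thus "x powr ((\<alpha> + 1) / 2) * bessel_Y \<nu> (c * complex_of_real x) = ?U (complex_of_real (ln x))"
      using bessel_Y_int[OF _ True] x by (simp add: V' algebra_simps del: of_real_divide)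
  qed
  thus ?thesis by blast
qed

end

section \<open>A priori estimates for the radial equation\<close>

text \<open>At a positive interior maximum f' vanishes, and f'' > 0 would make f increase to the
  right of it. Only the sign of f'' at that point is used, so f'' need not be continuous.\<close>

lemma nonpos_of_no_positive_max:
  fixes f f1 f2 :: "real \<Rightarrow> real"
  assumes f: "\<And>x. x \<in> {a..b} \<Longrightarrow> (f has_real_derivative f1 x) (at x)"
    and f1: "\<And>x. x \<in> {a..b} \<Longrightarrow> (f1 has_real_derivative f2 x) (at x)"
    and bd: "f a \<le> 0" "f b \<le> 0"
    and crit: "\<And>x. a < x \<Longrightarrow> x < b \<Longrightarrow> f x > 0 \<Longrightarrow> f1 x = 0 \<Longrightarrow> f2 x > 0"
    and x: "x \<in> {a..b}"
  shows "f x \<le> 0"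
proof (rule ccontr)
  assume "\<not> f x \<le> 0"
  have "continuous_on {a..b} f"
    using f by (meson DERIV_continuous_on has_field_derivative_at_within)
  then obtain y where y: "y \<in> {a..b}" "\<And>z. z \<in> {a..b} \<Longrightarrow> f z \<le> f y"
    using continuous_attains_sup[of "{a..b}" f] x by auto
  have pos: "f y > 0"
    using y(2)[OF x] \<open>\<not> f x \<le> 0\<close> by simp
  hence ab: "a < y" "y < b"
    using y(1) bd by (auto simp: less_le)
  have "f1 y = 0"
    by (rule DERIV_local_max[OF f[OF y(1)], of "min (y - a) (b - y)"]) (use ab y(2) in \<open>auto simp: abs_less_iff\<close>)
  hence "f2 y > 0"
    by (intro crit ab pos)
  then obtain d where d: "d > 0" "\<And>h. h > 0 \<Longrightarrow> h < d \<Longrightarrow> f1 y < f1 (y + h)"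
    using DERIV_pos_inc_right[OF f1[OF y(1)]] by blast
  define h where "h = min d (b - y) / 2"
  have h: "h > 0" "h < d" "y + h < b"
    using d(1) ab unfolding h_def by (auto simp: min_def field_simps)
  obtain z where z: "y < z" "z < y + h" "f (y + h) - f y = (y + h - y) * f1 z"
  proof -
    have "\<exists>z>y. z < y + h \<and> f (y + h) - f y = (y + h - y) * f1 z"
      by (rule MVT2) (use h ab in \<open>auto intro!: f\<close>)
    thus ?thesis using that by blast
  qed
  have "f1 z > 0"
    using d(2)[of "z - y"] z h \<open>f1 y = 0\<close> by simp
  hence "(y + h - y) * f1 z > 0"
    using h by simp
  hence "f (y + h) > f y"
    using z(3) by linarith
  thus False
    using y(2)[of "y + h"] h ab by simp
qed

lemma weinstein_ode_Re:
  assumes "weinstein_ode \<alpha> k u u1" "x > 0"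
  shows "((\<lambda>x. Re (\<omega> * u x)) has_real_derivative Re (\<omega> * u1 x)) (at x)"
    and "((\<lambda>x. Re (\<omega> * u1 x)) has_real_derivative \<alpha> / x * Re (\<omega> * u1 x) + k * Re (\<omega> * u x)) (at x)"
proof -
  have u: "(u has_vector_derivative u1 x) (at x)"
      "(u1 has_vector_derivative (\<alpha> / x) *\<^sub>R u1 x + k *\<^sub>R u x) (at x)"
    using assms by (auto simp: weinstein_ode_def)
  have bl: "bounded_linear (\<lambda>z. Re (\<omega> * z))"
    by (rule bounded_linear_compose[OF bounded_linear_Re bounded_linear_mult_right])
  show "((\<lambda>x. Re (\<omega> * u x)) has_real_derivative Re (\<omega> * u1 x)) (at x)"
    using bounded_linear.has_vector_derivative[OF bl u(1)]
    by (simp add: has_real_derivative_iff_has_vector_derivative)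
  have "Re (\<omega> * ((\<alpha> / x) *\<^sub>R u1 x + k *\<^sub>R u x)) = \<alpha> / x * Re (\<omega> * u1 x) + k * Re (\<omega> * u x)"
    by (simp add: distrib_left mult_scaleR_right del: times_complex.sel)
  thus "((\<lambda>x. Re (\<omega> * u1 x)) has_real_derivative \<alpha> / x * Re (\<omega> * u1 x) + k * Re (\<omega> * u x)) (at x)"
    using bounded_linear.has_vector_derivative[OF bl u(2)]
    by (simp add: has_real_derivative_iff_has_vector_derivative del: times_complex.sel)
qed

text \<open>Reduces bounds for a complex solution to real ones: the rotation is chosen for the
  single point at which the modulus is to be estimated, and the rotated real part again solves the
  equation, whose coefficients are real.\<close>

lemma obtain_rotation:
  fixes z :: complex
  obtains \<omega> where "norm \<omega> = 1" "Re (\<omega> * z) = norm z"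
proof (cases "z = 0")
  case True
  thus ?thesis using that[of 1] by simp
next
  case False
  show ?thesis
  proof (rule that)
    show "norm (cnj z / norm z) = 1"
      using False by (simp add: norm_divide)
    have "cnj z / norm z * z = norm z"
      using False by (simp add: complex_norm_square[symmetric] mult.commute[of "cnj z"] power2_eq_square)
    thus "Re (cnj z / norm z * z) = norm z" by simp
  qed
qed

lemma Re_rotation_le: "norm \<omega> = 1 \<Longrightarrow> Re (\<omega> * z) \<le> norm z"
  using complex_Re_le_cmod[of "\<omega> * z"] by (simp add: norm_mult)

lemma abs_Re_rotation_le: "norm \<omega> = 1 \<Longrightarrow> \<bar>Re (\<omega> * z)\<bar> \<le> norm z"
  using abs_Re_le_cmod[of "\<omega> * z"] by (simp add: norm_mult)

text \<open>Comparison with a supersolution B. Where Re (\<omega> u) exceeds B and the first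
  derivatives agree, the first-order terms match and \<open>k > 0\<close> makes the second
  derivative of the difference positive, which excludes a maximum there.\<close>

lemma weinstein_ode_barrier:
  assumes u: "weinstein_ode \<alpha> k u u1" and k: "k > 0" and a: "a > 0"
    and B: "\<And>y. (B has_real_derivative B1 y) (at y)" "\<And>y. (B1 has_real_derivative B2 y) (at y)"
    and super: "\<And>y. a < y \<Longrightarrow> y < b \<Longrightarrow> B2 y - \<alpha> / y * B1 y \<le> k * B y"
    and bd: "norm (u a) \<le> B a" "norm (u b) \<le> B b"
    and x: "x \<in> {a..b}"
  shows "norm (u x) \<le> B x"
proof -
  obtain \<omega> where \<omega>: "norm \<omega> = 1" "Re (\<omega> * u x) = norm (u x)"
    by (rule obtain_rotation)
  have "Re (\<omega> * u x) - B x \<le> 0"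
  proof (rule nonpos_of_no_positive_max[where a = a and b = b and f = "\<lambda>x. Re (\<omega> * u x) - B x"
        and ?f1.0 = "\<lambda>x. Re (\<omega> * u1 x) - B1 x"
        and ?f2.0 = "\<lambda>x. \<alpha> / x * Re (\<omega> * u1 x) + k * Re (\<omega> * u x) - B2 x"])
    show "Re (\<omega> * u a) - B a \<le> 0" "Re (\<omega> * u b) - B b \<le> 0"
      using bd Re_rotation_le[OF \<omega>(1), of "u a"] Re_rotation_le[OF \<omega>(1), of "u b"] by linarith+
    fix y assume y: "a < y" "y < b" "Re (\<omega> * u y) - B y > 0" "Re (\<omega> * u1 y) - B1 y = 0"
    have "k * B y < k * Re (\<omega> * u y)"
      using y(3) k by simp
    moreover have "Re (\<omega> * u1 y) = B1 y" using y(4) by linarith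
    ultimately show "\<alpha> / y * Re (\<omega> * u1 y) + k * Re (\<omega> * u y) - B2 y > 0"
      using super[OF y(1,2)] by (simp only:)
  next
    fix y assume "y \<in> {a..b}"
    hence "y > 0" using a by simp
    show "((\<lambda>x. Re (\<omega> * u x) - B x) has_real_derivative Re (\<omega> * u1 y) - B1 y) (at y)"
      "((\<lambda>x. Re (\<omega> * u1 x) - B1 x) has_real_derivative
        \<alpha> / y * Re (\<omega> * u1 y) + k * Re (\<omega> * u y) - B2 y) (at y)"
      by (intro DERIV_diff weinstein_ode_Re[OF u \<open>y > 0\<close>] B)+
  qed (rule x)
  thus ?thesis using \<omega>(2) by linarith
qed

lemma weinstein_ode_max:
  assumes "weinstein_ode \<alpha> k u u1" "k > 0" "a > 0" "x \<in> {a..b}"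
  shows "norm (u x) \<le> norm (u a) + norm (u b)"
  by (rule weinstein_ode_barrier[where B = "\<lambda>_. norm (u a) + norm (u b)" and ?B1.0 = "\<lambda>_. 0" and ?B2.0 = "\<lambda>_. 0", OF assms(1-3)])
     (use assms(2,4) in auto)

text \<open>The barrier is a parabola centred at the point x itself: it dominates M at x - r and x +
  r, and has height M K / k at the centre. The separate lower bound \<open>a\<close> fixes K, so
  that a second application on a smaller interval has the same constant.\<close>

lemma weinstein_ode_decay:
  assumes u: "weinstein_ode \<alpha> k u u1" and k: "k > 0" and a: "a > 0" "a \<le> a'" and r: "r > 0"
    and M: "\<And>y. y \<in> {a'..b} \<Longrightarrow> norm (u y) \<le> M"
    and x: "x \<in> {a' + r..b - r}"
  shows "norm (u x) \<le> (2 / r\<^sup>2 + 2 * \<bar>\<alpha>\<bar> / (a * r)) / k * M"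
proof -
  define K where "K = 2 / r\<^sup>2 + 2 * \<bar>\<alpha>\<bar> / (a * r)"
  have M0: "M \<ge> 0"
    using order_trans[OF norm_ge_zero M[of x]] x r by simp
  have K0: "K \<ge> 0"
    using a r by (simp add: K_def)
  \<comment> \<open>K is the largest possible value of 2/r^2 minus the first-order term on the
    window; the constant K / k thus makes the parabola a supersolution.\<close>
  let ?B = "\<lambda>y. M * ((y - x)\<^sup>2 / r\<^sup>2 + K / k)"
  have "norm (u x) \<le> ?B x"
  proof (rule weinstein_ode_barrier[OF u k, where a = "x - r" and b = "x + r" and B = ?B
        and ?B1.0 = "\<lambda>y. M * (2 * (y - x) / r\<^sup>2)" and ?B2.0 = "\<lambda>y. M * (2 / r\<^sup>2)"])
    show "x - r > 0" "x \<in> {x - r..x + r}" using x a r by auto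
    have "M \<le> M * (1 + K / k)"
      using M0 K0 k by (simp add: distrib_left)
    moreover have "norm (u (x - r)) \<le> M" "norm (u (x + r)) \<le> M"
      using x r by (auto intro!: M)
    ultimately show "norm (u (x - r)) \<le> M * ((x - r - x)\<^sup>2 / r\<^sup>2 + K / k)"
        "norm (u (x + r)) \<le> M * ((x + r - x)\<^sup>2 / r\<^sup>2 + K / k)"
      using r by auto
    fix y
    show "((\<lambda>y. M * ((y - x)\<^sup>2 / r\<^sup>2 + K / k)) has_real_derivative M * (2 * (y - x) / r\<^sup>2)) (at y)"
      "((\<lambda>y. M * (2 * (y - x) / r\<^sup>2)) has_real_derivative M * (2 / r\<^sup>2)) (at y)"
      using r by (auto intro!: derivative_eq_intros simp: field_simps eval_nat_numeral)
    assume y: "x - r < y" "y < x + r"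
    have ya: "a \<le> y" using x y a by auto
    have "- (\<alpha> / y * (2 * (y - x) / r\<^sup>2)) \<le> \<bar>\<alpha>\<bar> / y * (2 * \<bar>y - x\<bar> / r\<^sup>2)"
      using abs_ge_minus_self[of "\<alpha> / y * (2 * (y - x) / r\<^sup>2)"] ya a
      by (simp add: abs_mult del: right_diff_distrib_numeral)
    also have "\<dots> \<le> \<bar>\<alpha>\<bar> / a * (2 * r / r\<^sup>2)"
      using ya a y r by (intro mult_mono divide_left_mono divide_right_mono) auto
    also have "\<dots> = 2 * \<bar>\<alpha>\<bar> / (a * r)"
      using r by (simp add: power2_eq_square)
    finally have "2 / r\<^sup>2 - \<alpha> / y * (2 * (y - x) / r\<^sup>2) \<le> K"
      by (simp add: K_def)
    also have "\<dots> \<le> k * ((y - x)\<^sup>2 / r\<^sup>2 + K / k)"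
      using k by (simp add: distrib_left)
    finally have "M * (2 / r\<^sup>2 - \<alpha> / y * (2 * (y - x) / r\<^sup>2)) \<le> M * (k * ((y - x)\<^sup>2 / r\<^sup>2 + K / k))"
      using M0 by (rule mult_left_mono)
    thus "M * (2 / r\<^sup>2) - \<alpha> / y * (M * (2 * (y - x) / r\<^sup>2)) \<le> k * (M * ((y - x)\<^sup>2 / r\<^sup>2 + K / k))"
      by (simp only: right_diff_distrib mult.left_commute[of M])
  qed
  thus ?thesis by (simp add: K_def mult.commute)
qed

lemma powr_ratio_le:
  fixes y z a b :: real
  assumes "0 < a" "y \<in> {a..b}" "z \<in> {a..b}"
  shows "y powr \<alpha> * z powr (- \<alpha>) \<le> (b / a) powr \<bar>\<alpha>\<bar>"
proof (cases "\<alpha> \<ge> 0")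
  case True
  have "y powr \<alpha> * z powr (- \<alpha>) = (y / z) powr \<alpha>"
    using assms by (simp add: powr_divide powr_minus field_simps)
  also have "\<dots> \<le> (b / a) powr \<alpha>"
    using assms True by (intro powr_mono2 frac_le) auto
  finally show ?thesis using True by simp
next
  case False
  have "y powr \<alpha> * z powr (- \<alpha>) = (z / y) powr (- \<alpha>)"
    using assms by (simp add: powr_divide powr_minus field_simps)
  also have "\<dots> \<le> (b / a) powr (- \<alpha>)"
    using assms False by (intro powr_mono2 frac_le) auto
  finally show ?thesis using False by simp
qed

text \<open>The mean value theorem on [x, x + r] gives a point p where the derivative is at most 2 S
  / r. The integrating factor y^(-\<alpha>) removes the first-order term, so going back from p to x
  costs only r k S, up to the ratio of the weights.\<close>

lemma weinstein_ode_derivative_bound: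
  assumes u: "weinstein_ode \<alpha> k u u1" and k: "k > 0" and a: "a > 0" and r: "r > 0"
    and S: "\<And>y. y \<in> {a..b} \<Longrightarrow> norm (u y) \<le> S"
    and x: "x \<in> {a..b - r}"
  shows "norm (u1 x) \<le> (b / a) powr \<bar>\<alpha>\<bar> * (2 / r + r * k) * S"
proof -
  define L where "L = (b / a) powr \<bar>\<alpha>\<bar>"
  have L: "y powr \<alpha> * z powr (- \<alpha>) \<le> L" if "y \<in> {a..b}" "z \<in> {a..b}" for y z
    unfolding L_def by (rule powr_ratio_le[OF a that])
  have L0: "L \<ge> 0" by (simp add: L_def)
  have S0: "S \<ge> 0"
    using order_trans[OF norm_ge_zero S[of x]] x r by simp
  obtain \<omega> where \<omega>: "norm \<omega> = 1" "Re (\<omega> * u1 x) = norm (u1 x)"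
    by (rule obtain_rotation)
  define f f1 where "f y = Re (\<omega> * u y)" and "f1 y = Re (\<omega> * u1 y)" for y
  have f: "(f has_real_derivative f1 y) (at y)"
      "(f1 has_real_derivative \<alpha> / y * f1 y + k * f y) (at y)" if "y > 0" for y
    unfolding f_def f1_def by (rule weinstein_ode_Re[OF u that])+
  have fS: "\<bar>f y\<bar> \<le> S" if "y \<in> {a..b}" for y
    unfolding f_def using abs_Re_rotation_le[OF \<omega>(1), of "u y"] S[OF that] by linarith
  define g where "g y = y powr (- \<alpha>) * f1 y" for y
  have g: "(g has_real_derivative k * (y powr (- \<alpha>) * f y)) (at y)" if "y > 0" for y
  proof -
    have "(g has_real_derivative (- \<alpha> * y powr (- \<alpha> - 1)) * f1 y
        + (\<alpha> / y * f1 y + k * f y) * y powr (- \<alpha>)) (at y)"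
      unfolding g_def by (intro DERIV_mult f(2)[OF that] has_real_derivative_powr that)
    also have "y powr (- \<alpha> - 1) = y powr (- \<alpha>) / y"
      using that by (simp add: powr_diff)
    finally show ?thesis by (simp add: algebra_simps)
  qed
  have dom: "\<And>y. x \<le> y \<Longrightarrow> y \<le> x + r \<Longrightarrow> y \<in> {a..b} \<and> y > 0"
    using x a by auto
  obtain p where p: "x < p" "p < x + r" "f (x + r) - f x = (x + r - x) * f1 p"
  proof -
    have "\<exists>p>x. p < x + r \<and> f (x + r) - f x = (x + r - x) * f1 p"
      by (rule MVT2) (use r dom in \<open>auto intro!: f(1)\<close>)
    thus ?thesis using that by blast
  qed
  obtain q where q: "x < q" "q < p" "g p - g x = (p - x) * (k * (q powr (- \<alpha>) * f q))"
  proof -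
    have "\<exists>q>x. q < p \<and> g p - g x = (p - x) * (k * (q powr (- \<alpha>) * f q))"
      by (rule MVT2) (use p dom in \<open>auto intro!: g\<close>)
    thus ?thesis using that by blast
  qed
  have in_ab: "x \<in> {a..b}" "p \<in> {a..b}" "q \<in> {a..b}" "x + r \<in> {a..b}"
    using dom[of x] dom[of p] dom[of q] dom[of "x + r"] p q r by auto
  have "r * \<bar>f1 p\<bar> \<le> 2 * S"
    using fS[of x] fS[of "x + r"] in_ab p(3) r by (simp add: abs_mult[symmetric])
  hence f1p: "\<bar>f1 p\<bar> \<le> 2 * S / r"
    using r by (simp add: field_simps)
  have "f1 x = x powr \<alpha> * g x"
    using dom[of x] r by (simp add: g_def powr_minus)
  also have "g x = p powr (- \<alpha>) * f1 p - (p - x) * (k * (q powr (- \<alpha>) * f q))"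
    using q(3) by (simp add: g_def)
  also have "x powr \<alpha> * \<dots> = (x powr \<alpha> * p powr (- \<alpha>)) * f1 p
      - (p - x) * k * ((x powr \<alpha> * q powr (- \<alpha>)) * f q)"
    by (simp add: algebra_simps)
  also have "\<bar>\<dots>\<bar> \<le> (x powr \<alpha> * p powr (- \<alpha>)) * \<bar>f1 p\<bar>
      + (p - x) * k * ((x powr \<alpha> * q powr (- \<alpha>)) * \<bar>f q\<bar>)"
    using p(1) k by (intro order_trans[OF abs_triangle_ineq4]) (simp add: abs_mult)
  also have "\<dots> \<le> L * (2 * S / r) + r * k * (L * S)"
    using in_ab L L0 S0 f1p fS p k r by (intro add_mono mult_mono) auto
  also have "\<dots> = L * (2 / r + r * k) * S"
    by (simp add: algebra_simps)
  finally show ?thesis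
    using \<omega>(2) by (simp add: f1_def L_def)
qed

text \<open>Two shrinkings of the interval gain \<open>k\<^sup>2\<close>, enough to pay for two derivatives.\<close>

lemma weinstein_ode_interior_estimate:
  fixes \<alpha> a b r :: real
  assumes a: "a > 0" and r: "r > 0"
  obtains C where "C \<ge> 0"
    "\<And>k u u1 x. weinstein_ode \<alpha> k u u1 \<Longrightarrow> k \<ge> 1 \<Longrightarrow> x \<in> {a + 2 * r..b - 3 * r} \<Longrightarrow>
       norm (u x) \<le> C * (norm (u a) + norm (u b)) / k\<^sup>2 \<and>
       norm (u1 x) \<le> C * (norm (u a) + norm (u b)) / k"
proof -
  define K where "K = 2 / r\<^sup>2 + 2 * \<bar>\<alpha>\<bar> / (a * r)"
  define L where "L = ((b - 2 * r) / (a + 2 * r)) powr \<bar>\<alpha>\<bar>"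
  define C where "C = K\<^sup>2 * (1 + L * (2 / r + r))"
  have L0: "L \<ge> 0" by (simp add: L_def)
  have C0: "C \<ge> 0" "C \<ge> K\<^sup>2" "C \<ge> K\<^sup>2 * (L * (2 / r + r))"
    using L0 r by (simp_all add: C_def distrib_left)
  show ?thesis
  proof (rule that[OF C0(1)])
    fix k u u1 x
    assume u: "weinstein_ode \<alpha> k u u1" and k: "k \<ge> (1::real)" and x: "x \<in> {a + 2 * r..b - 3 * r}"
    define N where "N = norm (u a) + norm (u b)"
    have N0: "N \<ge> 0" by (simp add: N_def)
    have k0: "k > 0" using k by simp
    have 0: "norm (u y) \<le> N" if "y \<in> {a..b}" for y
      unfolding N_def by (rule weinstein_ode_max[OF u k0 a that])
    have 1: "norm (u y) \<le> K / k * N" if "y \<in> {a + r..b - r}" for y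
      unfolding K_def by (rule weinstein_ode_decay[OF u k0 a order_refl r 0 that])
    have 2: "norm (u y) \<le> K / k * (K / k * N)" if "y \<in> {a + 2 * r..b - 2 * r}" for y
      unfolding K_def
      by (rule weinstein_ode_decay[OF u k0 a _ r 1[unfolded K_def], where a' = "a + r" and b = "b - r"])
         (use that r in auto)
    have S: "norm (u y) \<le> K\<^sup>2 * N / k\<^sup>2" if "y \<in> {a + 2 * r..b - 2 * r}" for y
      using 2[OF that] by (simp add: power2_eq_square)
    have "norm (u x) \<le> C * N / k\<^sup>2"
      using S[of x] x r C0(2) N0
      by (intro order_trans[OF S] divide_right_mono mult_right_mono) auto
    \<comment> \<open>The derivative bound needs room r to the right of x; hence b - 3 r where the
      bound for u alone would allow b - 2 r.\<close>
    moreover have "norm (u1 x) \<le> L * (2 / r + r * k) * (K\<^sup>2 * N / k\<^sup>2)"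
      unfolding L_def
      by (rule weinstein_ode_derivative_bound[OF u k0 _ r S]) (use a r x in auto)
    moreover have "L * (2 / r + r * k) * (K\<^sup>2 * N / k\<^sup>2) \<le> L * ((2 / r + r) * k) * (K\<^sup>2 * N / k\<^sup>2)"
    proof -
      have "2 / r \<le> 2 / r * k" using k r by (simp add: field_simps)
      thus ?thesis
        using L0 N0 by (intro mult_right_mono mult_left_mono) (auto simp: distrib_right)
    qed
    moreover have "L * ((2 / r + r) * k) * (K\<^sup>2 * N / k\<^sup>2) = K\<^sup>2 * (L * (2 / r + r)) * N / k"
      using k0 by (simp add: power2_eq_square)
    moreover have "\<dots> \<le> C * N / k"
      using C0(3) N0 k0 by (intro divide_right_mono mult_right_mono) auto
    ultimately show "norm (u x) \<le> C * (norm (u a) + norm (u b)) / k\<^sup>2 \<and>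
       norm (u1 x) \<le> C * (norm (u a) + norm (u b)) / k"
      unfolding N_def by linarith
  qed
qed

section \<open>Absolute convergence of trigonometric series\<close>

lemma finite_int_abs_less: "finite {l::int. real_of_int \<bar>l\<bar> < c}"
proof (rule finite_subset)
  show "{l::int. real_of_int \<bar>l\<bar> < c} \<subseteq> {- \<lceil>c\<rceil>..\<lceil>c\<rceil>}"
    by (auto simp: abs_if less_ceiling_iff split: if_splits) linarith+
qed simp

lemma Baire_closed_cover:
  fixes E :: "nat \<Rightarrow> 'a::{real_normed_vector,heine_borel} set"
  assumes "\<And>n. closed (E n)" "(\<Union>n. E n) = UNIV"
  obtains n p \<delta> where "\<delta> > 0" "ball p \<delta> \<subseteq> E n"
proof -
  have "\<exists>n. interior (E n) \<noteq> {}"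
  proof (rule ccontr)
    assume "\<nexists>n. interior (E n) \<noteq> {}"
    hence "UNIV \<subseteq> closure (\<Inter>n. - E n)"
      using assms(1) by (intro Baire) (auto simp: closure_complement)
    moreover have "(\<Inter>n. - E n) = {}"
      using assms(2) by auto
    ultimately show False by simp
  qed
  then obtain n p where "p \<in> interior (E n)" by blast
  thus ?thesis
    using that by (auto simp: mem_interior)
qed

lemma has_integral_sin_squared:
  fixes c d :: real
  assumes "c \<noteq> 0" "d \<ge> 0"
  shows "((\<lambda>t. (sin (c * t))\<^sup>2) has_integral d / 2 - sin (2 * c * d) / (4 * c)) {0..d}"
proof -
  have "((\<lambda>t. t / 2 - sin (2 * c * t) / (4 * c)) has_vector_derivative (sin (c * t))\<^sup>2) (at t within {0..d})" for t
  proof -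
    have "((\<lambda>t. t / 2 - sin (2 * c * t) / (4 * c)) has_real_derivative 1 / 2 - cos (2 * c * t) / 2) (at t within {0..d})"
      using assms by (auto intro!: derivative_eq_intros)
    also have "1 / 2 - cos (2 * c * t) / 2 = (sin (c * t))\<^sup>2"
      using cos_double_sin[of "c * t"] by (simp add: mult.assoc field_simps)
    finally show ?thesis
      by (simp add: has_real_derivative_iff_has_vector_derivative)
  qed
  from fundamental_theorem_of_calculus[OF assms(2) this] show ?thesis by simp
qed

text \<open>By Baire the partial sums are uniformly bounded on some interval, hence, by the addition theorem,
  on an interval \<open>[0, d]\<close>; there the integral of \<open>\<bar>sin (l * t)\<bar>\<close> is at least \<open>d / 4\<close> for large \<open>l\<close>.\<close>

lemma summable_of_summable_sin_series:
  fixes e :: "int \<Rightarrow> real"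
  assumes e: "\<And>l. e l \<ge> 0"
    and s: "\<And>x. (\<lambda>l. e l * \<bar>sin (of_int l * x)\<bar>) summable_on UNIV"
  shows "e summable_on UNIV"
proof -
  define E where "E M = {x. \<forall>A. finite A \<longrightarrow> (\<Sum>l\<in>A. e l * \<bar>sin (of_int l * x)\<bar>) \<le> real M}" for M :: nat
  have cl: "closed (E M)" for M
  proof -
    have "E M = (\<Inter>A\<in>{A. finite A}. {x. (\<Sum>l\<in>A. e l * \<bar>sin (of_int l * x)\<bar>) \<le> real M})"
      by (auto simp: E_def)
    thus ?thesis
      by (auto intro!: closed_INT closed_Collect_le continuous_intros)
  qed
  have "x \<in> (\<Union>M. E M)" for x
  proof -
    obtain M where M: "(\<Sum>\<^sub>\<infinity>l. e l * \<bar>sin (of_int l * x)\<bar>) \<le> real M"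
      using real_arch_simple by blast
    have "(\<Sum>l\<in>A. e l * \<bar>sin (of_int l * x)\<bar>) \<le> (\<Sum>\<^sub>\<infinity>l. e l * \<bar>sin (of_int l * x)\<bar>)" if "finite A" for A
      using that e by (intro finite_sum_le_infsum s) auto
    hence "x \<in> E M"
      using M unfolding E_def by (auto intro: order_trans)
    thus ?thesis by blast
  qed
  hence cover: "(\<Union>M. E M) = UNIV" by blast
  obtain M p \<delta> where \<delta>: "\<delta> > 0" and ball: "ball p \<delta> \<subseteq> E M"
    by (rule Baire_closed_cover[OF cl cover])
  have bound: "(\<Sum>l\<in>A. e l * \<bar>sin (of_int l * t)\<bar>) \<le> 2 * real M"
    if "finite A" "0 \<le> t" "t < \<delta>" for A t
  proof -
    have "\<bar>sin (of_int l * t)\<bar> \<le> \<bar>sin (of_int l * (p + t))\<bar> + \<bar>sin (of_int l * p)\<bar>" for l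
    proof -
      let ?u = "of_int l * (p + t)" and ?v = "of_int l * p"
      have "sin (of_int l * t) = sin ?u * cos ?v - cos ?u * sin ?v"
        using sin_diff[of ?u ?v] by (simp add: algebra_simps)
      also have "\<bar>\<dots>\<bar> \<le> \<bar>sin ?u\<bar> * \<bar>cos ?v\<bar> + \<bar>cos ?u\<bar> * \<bar>sin ?v\<bar>"
        using abs_triangle_ineq4[of "sin ?u * cos ?v" "cos ?u * sin ?v"] by (simp only: abs_mult)
      also have "\<dots> \<le> \<bar>sin ?u\<bar> * 1 + 1 * \<bar>sin ?v\<bar>"
        by (intro add_mono mult_mono) auto
      finally show ?thesis by simp
    qed
    hence "(\<Sum>l\<in>A. e l * \<bar>sin (of_int l * t)\<bar>)
        \<le> (\<Sum>l\<in>A. e l * (\<bar>sin (of_int l * (p + t))\<bar> + \<bar>sin (of_int l * p)\<bar>))"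
      using e by (intro sum_mono mult_left_mono) auto
    also have "\<dots> = (\<Sum>l\<in>A. e l * \<bar>sin (of_int l * (p + t))\<bar>) + (\<Sum>l\<in>A. e l * \<bar>sin (of_int l * p)\<bar>)"
      by (simp add: distrib_left sum.distrib)
    also have "\<dots> \<le> real M + real M"
    proof -
      have "p + t \<in> E M" "p \<in> E M"
        using ball that \<delta> by (auto simp: dist_norm subset_iff)
      thus ?thesis using that(1) unfolding E_def by (intro add_mono) auto
    qed
    finally show ?thesis by simp
  qed
  define d where "d = \<delta> / 2"
  have d: "d > 0" "d < \<delta>" using \<delta> by (auto simp: d_def)
  \<comment> \<open>Outside B the boundary term sin (2 l d) / (4 l) of the integral is at most d/4,
    half of the main term d/2.\<close>
  define B where "B = {l::int. real_of_int \<bar>l\<bar> < 1 / d}"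
  have "finite B"
    unfolding B_def by (rule finite_int_abs_less)
  \<comment> \<open>The square of the sine lies below its modulus and has an elementary primitive.
    Integrating over [0, d] compares d/4 per term with 2 M d in total, which gives the factor
    8.\<close>
  have "(\<Sum>l\<in>A. e l) \<le> 8 * real M" if A: "finite A" "A \<subseteq> - B" for A
  proof -
    have l: "1 \<le> real_of_int \<bar>l\<bar> * d" "l \<noteq> 0" if "l \<in> A" for l
      using that A(2) d by (auto simp: B_def field_simps not_less)
    have "((\<lambda>t. \<Sum>l\<in>A. e l * (sin (of_int l * t))\<^sup>2) has_integral
        (\<Sum>l\<in>A. e l * (d / 2 - sin (2 * of_int l * d) / (4 * of_int l)))) {0..d}"
      using A(1) l d by (intro has_integral_sum has_integral_mult_right has_integral_sin_squared) auto
    moreover have "((\<lambda>_. 2 * real M) has_integral 2 * real M * d) {0..d}"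
      using has_integral_const_real[of "2 * real M" 0 d] d by (simp add: mult.commute)
    moreover have "(\<Sum>l\<in>A. e l * (sin (of_int l * t))\<^sup>2) \<le> 2 * real M" if "t \<in> {0..d}" for t
    proof -
      have "(sin y)\<^sup>2 \<le> \<bar>sin y\<bar>" for y :: real
        using power_decreasing[of 1 2 "\<bar>sin y\<bar>"] by simp
      hence "(\<Sum>l\<in>A. e l * (sin (of_int l * t))\<^sup>2) \<le> (\<Sum>l\<in>A. e l * \<bar>sin (of_int l * t)\<bar>)"
        using e by (intro sum_mono mult_left_mono) auto
      also have "\<dots> \<le> 2 * real M"
        using that d A(1) by (intro bound) auto
      finally show ?thesis .
    qed
    ultimately have "(\<Sum>l\<in>A. e l * (d / 2 - sin (2 * of_int l * d) / (4 * of_int l))) \<le> 2 * real M * d"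
      by (rule has_integral_le)
    moreover have "(\<Sum>l\<in>A. e l * (d / 4)) \<le> (\<Sum>l\<in>A. e l * (d / 2 - sin (2 * of_int l * d) / (4 * of_int l)))"
    proof (intro sum_mono mult_left_mono e)
      fix l assume "l \<in> A"
      note l = l[OF this]
      have "sin (2 * of_int l * d) / (4 * of_int l) \<le> \<bar>sin (2 * of_int l * d)\<bar> / (4 * \<bar>of_int l\<bar>)"
        using abs_ge_self[of "sin (2 * of_int l * d) / (4 * of_int l)"] by (simp add: abs_mult)
      also have "\<dots> \<le> 1 / (4 * \<bar>of_int l\<bar>)"
        using l by (intro divide_right_mono) auto
      also have "\<dots> \<le> d / 4"
        using l by (simp add: field_simps)
      finally show "d / 4 \<le> d / 2 - sin (2 * of_int l * d) / (4 * of_int l)" by simp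
    qed
    ultimately have "(\<Sum>l\<in>A. e l) * (d / 4) \<le> 8 * real M * (d / 4)"
      unfolding sum_distrib_right by linarith
    thus ?thesis
      using d by (simp only: mult_le_cancel_right)
  qed
  hence "e summable_on - B"
    using e by (intro nonneg_bdd_above_summable_on bdd_aboveI[of _ "8 * real M"]) auto
  hence "e summable_on (B \<union> - B)"
    using \<open>finite B\<close> by (intro summable_on_Un_disjoint[OF summable_on_finite]) auto
  thus ?thesis by (simp add: Compl_partition)
qed

text \<open>A version of the Denjoy--Lusin theorem.\<close>

lemma summable_amplitudes:
  fixes C1 C2 d :: "int \<Rightarrow> real"
  assumes d: "\<And>l. d l \<ge> 0"
    and s: "\<And>x. (\<lambda>l. \<bar>C1 l * cos (of_int l * x) + C2 l * sin (of_int l * x)\<bar> * d l) summable_on UNIV"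
  shows "(\<lambda>l. (\<bar>C1 l\<bar> + \<bar>C2 l\<bar>) * d l) summable_on UNIV"
proof -
  \<comment> \<open>At x = 0 the sines vanish, so the cosine amplitudes are summable at once;
    subtracting them leaves a pure sine series.\<close>
  have 1: "(\<lambda>l. \<bar>C1 l\<bar> * d l) summable_on UNIV"
    using s[of 0] by simp
  have 2: "(\<lambda>l. (\<bar>C2 l\<bar> * d l) * \<bar>sin (of_int l * x)\<bar>) summable_on UNIV" for x
  proof (rule summable_on_comparison_test[OF summable_on_add[OF s[of x] 1]])
    fix l
    let ?c = "C1 l * cos (of_int l * x)" and ?s = "C2 l * sin (of_int l * x)"
    have "\<bar>C1 l\<bar> * \<bar>cos (of_int l * x)\<bar> \<le> \<bar>C1 l\<bar> * 1"
      by (intro mult_left_mono) auto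
    hence "\<bar>?c\<bar> \<le> \<bar>C1 l\<bar>" by (simp add: abs_mult)
    moreover have "\<bar>?s\<bar> \<le> \<bar>?c + ?s\<bar> + \<bar>?c\<bar>" by linarith
    ultimately have "\<bar>?s\<bar> * d l \<le> (\<bar>?c + ?s\<bar> + \<bar>C1 l\<bar>) * d l"
      by (intro mult_right_mono d) linarith
    thus "\<bar>C2 l\<bar> * d l * \<bar>sin (of_int l * x)\<bar> \<le> \<bar>?c + ?s\<bar> * d l + \<bar>C1 l\<bar> * d l"
      by (simp add: abs_mult algebra_simps)
  qed (use d in auto)
  have "(\<lambda>l. \<bar>C2 l\<bar> * d l) summable_on UNIV"
    by (rule summable_of_summable_sin_series[OF _ 2]) (simp add: d)
  from summable_on_add[OF 1 this] show ?thesis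
    by (simp add: distrib_right)
qed

section \<open>Termwise partial differentiation\<close>

lemma frechet_derivative_partial:
  assumes "f differentiable (at y)"
  shows "frechet_derivative f (at y) h = (\<Sum>i\<in>UNIV. (h $ i) *\<^sub>R partial i f y)"
proof -
  have lin: "linear (frechet_derivative f (at y))"
    using assms by (rule linear_frechet_derivative)
  have "frechet_derivative f (at y) h = frechet_derivative f (at y) (\<Sum>i\<in>UNIV. (h $ i) *\<^sub>R axis i 1)"
    using basis_expansion[of h] by (simp add: scalar_mult_eq_scaleR)
  also have "\<dots> = (\<Sum>i\<in>UNIV. (h $ i) *\<^sub>R partial i f y)"
    by (simp add: linear_sum[OF lin] linear_scale[OF lin] partial_def)
  finally show ?thesis .
qed

lemma norm_frechet_derivative_le:
  fixes f :: "real^'n::finite \<Rightarrow> 'a::real_normed_vector"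
  assumes "f differentiable (at y)" "\<And>i. norm (partial i f y) \<le> M"
  shows "norm (frechet_derivative f (at y) h) \<le> real CARD('n) * norm h * M"
proof -
  have "norm (frechet_derivative f (at y) h) \<le> (\<Sum>i\<in>UNIV. norm ((h $ i) *\<^sub>R partial i f y))"
    unfolding frechet_derivative_partial[OF assms(1)] by (rule norm_sum)
  also have "\<dots> \<le> (\<Sum>i\<in>(UNIV::'n set). norm h * M)"
    using component_le_norm_cart[of h] assms(2) by (intro sum_mono) (auto intro!: mult_mono)
  finally show ?thesis by simp
qed

lemma partial_cong_open:
  assumes "f differentiable (at x)" "open S" "x \<in> S" "\<And>y. y \<in> S \<Longrightarrow> f y = g y"
  shows "partial i f x = partial i g x"
  unfolding partial_def using frechet_derivative_transform_within_open[OF assms] by simp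

lemma differentiable_cong_open:
  assumes "f differentiable (at x)" "open S" "x \<in> S" "\<And>y. y \<in> S \<Longrightarrow> f y = g y"
  shows "g differentiable (at x)"
  using assms has_derivative_transform_within_open[of f _ x UNIV S g] unfolding differentiable_def by blast

text \<open>In finite dimension a majorant for the partial derivatives controls the whole
  derivative, uniformly over directions. The majorant may change from point to point, since
  differentiability is local.\<close>

lemma partial_series:
  fixes f :: "nat \<Rightarrow> real^'n::finite \<Rightarrow> 'a::banach"
  assumes S: "open S"
    and diff: "\<And>n x. x \<in> S \<Longrightarrow> f n differentiable (at x)"
    and loc: "\<And>x. x \<in> S \<Longrightarrow> \<exists>e>0. \<exists>M. summable M \<and>
        (\<forall>n. \<forall>y\<in>ball x e. norm (f n y) \<le> M n \<and> (\<forall>i. norm (partial i (f n) y) \<le> M n))"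
    and x: "x \<in> S"
  shows "(\<lambda>y. \<Sum>n. f n y) differentiable (at x)"
    and "partial i (\<lambda>y. \<Sum>n. f n y) x = (\<Sum>n. partial i (f n) x)"
proof -
  obtain e1 M where e1: "e1 > 0" and M: "summable M"
    and bd: "\<And>n y. y \<in> ball x e1 \<Longrightarrow> norm (f n y) \<le> M n"
      "\<And>n y i. y \<in> ball x e1 \<Longrightarrow> norm (partial i (f n) y) \<le> M n"
    using loc[OF x] by auto
  obtain e2 where e2: "e2 > 0" "ball x e2 \<subseteq> S"
    using S x open_contains_ball by blast
  \<comment> \<open>A ball, because the theorem on differentiating series needs a convex
    set.\<close>
  define U where "U = ball x (min e1 e2)"
  have U: "open U" "convex U" "x \<in> U" "U \<subseteq> S" "U \<subseteq> ball x e1"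
    using e1 e2 by (auto simp: U_def)
  define f' where "f' n y = frechet_derivative (f n) (at y)" for n y
  define g' where "g' y h = (\<Sum>n. f' n y h)" for y h
  have f'_le: "norm (f' n y h) \<le> real CARD('n) * norm h * M n" if "y \<in> U" for n y h
    unfolding f'_def using that U by (intro norm_frechet_derivative_le diff bd) auto
  have sum_f': "summable (\<lambda>n. norm (f' n y h))" if "y \<in> U" for y h
    by (rule summable_comparison_test'[OF summable_mult[OF M, of "real CARD('n) * norm h"]])
       (use f'_le[OF that] in auto)
  have "\<exists>g. \<forall>y\<in>U. (\<lambda>n. f n y) sums g y \<and> (g has_derivative g' y) (at y within U)"
  proof (rule has_derivative_series[OF U(2)])
    show "(f n has_derivative f' n y) (at y within U)" if "y \<in> U" for n y
      using diff[of y n] that U(4) unfolding f'_def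
      by (meson frechet_derivative_works has_derivative_at_withinI subsetD)
    show "x \<in> U" by (rule U)
    show "(\<lambda>n. f n x) sums (\<Sum>n. f n x)"
      by (rule summable_sums, rule summable_comparison_test'[OF M]) (use bd(1)[of x] e1 in auto)
    show "\<forall>\<^sub>F n in sequentially. \<forall>y\<in>U. \<forall>h. norm ((\<Sum>i<n. f' i y h) - g' y h) \<le> e * norm h" if "e > 0" for e
    proof -
      have e': "e / real CARD('n) > 0" using that by simp
      obtain N where N: "\<And>n. n \<ge> N \<Longrightarrow> norm (\<Sum>i. M (i + n)) < e / real CARD('n)"
        using suminf_exist_split[OF e' M] by auto
      show ?thesis
        unfolding eventually_sequentially
      proof (intro exI allI impI ballI)
        fix n y h assume n: "N \<le> n" and y: "y \<in> U"
        have "g' y h = (\<Sum>i. f' (i + n) y h) + (\<Sum>i<n. f' i y h)"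
          unfolding g'_def by (rule suminf_split_initial_segment[OF summable_norm_cancel[OF sum_f'[OF y]]])
        hence "norm ((\<Sum>i<n. f' i y h) - g' y h) = norm (\<Sum>i. f' (i + n) y h)"
          by simp
        also have "\<dots> \<le> (\<Sum>i. norm (f' (i + n) y h))"
          by (intro summable_norm summable_ignore_initial_segment sum_f' y)
        also have "\<dots> \<le> (\<Sum>i. real CARD('n) * norm h * M (i + n))"
          by (intro suminf_le f'_le y summable_mult summable_ignore_initial_segment M sum_f')
        also have "\<dots> = real CARD('n) * norm h * (\<Sum>i. M (i + n))"
          by (intro suminf_mult summable_ignore_initial_segment M)
        also have "\<dots> \<le> real CARD('n) * norm h * (e / real CARD('n))"
          using N[OF n] by (intro mult_left_mono) auto
        finally show "norm ((\<Sum>i<n. f' i y h) - g' y h) \<le> e * norm h"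
          by (simp add: mult.commute)
      qed
    qed
  qed
  then obtain g where g: "\<And>y. y \<in> U \<Longrightarrow> (\<lambda>n. f n y) sums g y" "(g has_derivative g' x) (at x within U)"
    using U(3) by blast
  have "(g has_derivative g' x) (at x)"
    using g(2) at_within_open[OF U(3,1)] by simp
  hence der: "((\<lambda>y. \<Sum>n. f n y) has_derivative g' x) (at x)"
    by (rule has_derivative_transform_within_open[OF _ U(1,3)]) (use g(1) in \<open>simp add: sums_iff\<close>)
  show "(\<lambda>y. \<Sum>n. f n y) differentiable (at x)"
    using der unfolding differentiable_def by blast
  show "partial i (\<lambda>y. \<Sum>n. f n y) x = (\<Sum>n. partial i (f n) x)"
    unfolding partial_def frechet_derivative_at[OF der, symmetric] g'_def f'_def ..
qed

text \<open>Termwise differentiation is applied twice, the second time to the series of the partial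
  derivatives. That series equals the partial derivative of the sum only on S, and openness of S
  carries the result over; continuity is the Weierstrass test.\<close>

lemma C2_on_series:
  fixes f :: "nat \<Rightarrow> real^'n::finite \<Rightarrow> 'a::banach"
  assumes S: "open S"
    and C2: "\<And>n. C2_on (f n) S"
    and loc: "\<And>x. x \<in> S \<Longrightarrow> \<exists>e>0. \<exists>M. summable M \<and>
        (\<forall>n. \<forall>y\<in>ball x e. norm (f n y) \<le> M n \<and> (\<forall>i. norm (partial i (f n) y) \<le> M n) \<and>
           (\<forall>i j. norm (partial j (partial i (f n)) y) \<le> M n))"
  shows "C2_on (\<lambda>y. \<Sum>n. f n y) S"
    and "x \<in> S \<Longrightarrow> partial i (\<lambda>y. \<Sum>n. f n y) x = (\<Sum>n. partial i (f n) x)"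
    and "x \<in> S \<Longrightarrow> partial j (partial i (\<lambda>y. \<Sum>n. f n y)) x = (\<Sum>n. partial j (partial i (f n)) x)"
proof -
  let ?F = "\<lambda>y. \<Sum>n. f n y"
  have diff: "f n differentiable (at x)" "partial i (f n) differentiable (at x)"
    "continuous_on S (partial j (partial i (f n)))" if "x \<in> S" for n i j x
    using C2[of n] that unfolding C2_on_def by auto
  have loc1: "\<exists>e>0. \<exists>M. summable M \<and>
        (\<forall>n. \<forall>y\<in>ball x e. norm (f n y) \<le> M n \<and> (\<forall>i. norm (partial i (f n) y) \<le> M n))" if "x \<in> S" for x
    using loc[OF that] by meson
  have loc2: "\<exists>e>0. \<exists>M. summable M \<and>
        (\<forall>n. \<forall>y\<in>ball x e. norm (partial i (f n) y) \<le> M n \<and> (\<forall>j. norm (partial j (partial i (f n)) y) \<le> M n))"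
    if "x \<in> S" for x i
    using loc[OF that] by meson
  have P1: "?F differentiable (at x)" "partial i ?F x = (\<Sum>n. partial i (f n) x)" if "x \<in> S" for x i
    by (rule partial_series[OF S diff(1) loc1 that]; assumption)+
  have P2: "(\<lambda>y. \<Sum>n. partial i (f n) y) differentiable (at x)"
      "partial j (\<lambda>y. \<Sum>n. partial i (f n) y) x = (\<Sum>n. partial j (partial i (f n)) x)" if "x \<in> S" for x i j
    by (rule partial_series[where f = "\<lambda>n. partial i (f n)", OF S diff(2) loc2 that]; assumption)+
  have P3: "partial i ?F differentiable (at x)" if "x \<in> S" for x i
    by (rule differentiable_cong_open[OF P2(1)[OF that] S that]) (use P1(2) in auto)
  have P4: "partial j (partial i ?F) x = (\<Sum>n. partial j (partial i (f n)) x)" if "x \<in> S" for x i j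
    unfolding P2(2)[OF that, symmetric]
    by (rule partial_cong_open[OF P3[OF that] S that]) (use P1(2) in auto)
  show "partial i ?F x = (\<Sum>n. partial i (f n) x)" if "x \<in> S" using P1(2) that .
  show "partial j (partial i ?F) x = (\<Sum>n. partial j (partial i (f n)) x)" if "x \<in> S" using P4 that .
  have "continuous_on S (partial j (partial i ?F))" for i j
  proof -
    have "continuous (at x) (\<lambda>x. \<Sum>n. partial j (partial i (f n)) x)" if x: "x \<in> S" for x
    proof -
      obtain e1 M where e1: "e1 > 0" and M: "summable M"
        and bd: "\<And>n y. y \<in> ball x e1 \<Longrightarrow> norm (partial j (partial i (f n)) y) \<le> M n"
        using loc[OF x] by meson
      obtain e2 where e2: "e2 > 0" "ball x e2 \<subseteq> S"
        using S x open_contains_ball by blast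
      define U where "U = ball x (min e1 e2)"
      have U: "open U" "x \<in> U" "U \<subseteq> S" "U \<subseteq> ball x e1"
        using e1 e2 by (auto simp: U_def)
      have "uniform_limit U (\<lambda>n x. \<Sum>k<n. partial j (partial i (f k)) x)
          (\<lambda>x. \<Sum>n. partial j (partial i (f n)) x) sequentially"
        by (rule Weierstrass_m_test[OF _ M]) (use bd U in auto)
      hence "continuous_on U (\<lambda>x. \<Sum>n. partial j (partial i (f n)) x)"
        by (rule uniform_limit_theorem[rotated])
           (auto intro!: always_eventually continuous_on_sum continuous_on_subset[OF diff(3)[OF x] U(3)])
      thus ?thesis
        using U(1,2) by (simp add: continuous_on_eq_continuous_at)
    qed
    hence "continuous_on S (\<lambda>x. \<Sum>n. partial j (partial i (f n)) x)"
      by (simp add: continuous_at_imp_continuous_on)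
    thus ?thesis
      by (rule continuous_on_eq) (simp add: P4)
  qed
  thus "C2_on ?F S"
    unfolding C2_on_def using P1(1) P3 by blast
qed

section \<open>Products of functions of one variable each on the upper half-space\<close>

lemma open_upper_half_space: "open upper_half_space"
  unfolding upper_half_space_def by (intro open_Collect_less continuous_intros)

definition tensor :: "(real \<Rightarrow> real) \<Rightarrow> (real \<Rightarrow> real) \<Rightarrow> (real \<Rightarrow> complex) \<Rightarrow> real^3 \<Rightarrow> complex" where
  "tensor p q r x = (p (x $ 0) * q (x $ 1)) *\<^sub>R r (x $ 2)"

lemma exhaust_3_from_0: "(d::3) = 0 \<or> d = 1 \<or> d = 2"
proof -
  have "(3::3) = 0" by simp
  thus ?thesis using exhaust_3[of d] by metis
qed

text \<open>The Kronecker delta as a count of derivatives: differentiating in direction d raises the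
  order in coordinate e by \<open>incr d e\<close>.\<close>

definition incr :: "3 \<Rightarrow> 3 \<Rightarrow> nat" where
  "incr d e = (if d = e then 1 else 0)"

lemma incr_sum: "incr d 0 + incr d 1 + incr d 2 = 1"
  using exhaust_3_from_0[of d] by (auto simp: incr_def)

lemma tensor_has_derivative:
  assumes p: "(p has_real_derivative p') (at (x $ 0))"
    and q: "(q has_real_derivative q') (at (x $ 1))"
    and r: "(r has_vector_derivative r') (at (x $ 2))"
  shows "(tensor p q r has_derivative (\<lambda>h.
      (h $ 0) *\<^sub>R ((p' * q (x $ 1)) *\<^sub>R r (x $ 2)) + (h $ 1) *\<^sub>R ((p (x $ 0) * q') *\<^sub>R r (x $ 2))
        + (h $ 2) *\<^sub>R ((p (x $ 0) * q (x $ 1)) *\<^sub>R r'))) (at x)"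
proof -
  have nth: "((\<lambda>x. x $ i) has_derivative (\<lambda>h. h $ i)) (at x)" for i
    by (rule bounded_linear_imp_has_derivative[OF bounded_linear_vec_nth])
  have P: "((\<lambda>x. p (x $ 0)) has_derivative (\<lambda>h. p' * h $ 0)) (at x)"
    using has_derivative_compose[OF nth p[unfolded has_field_derivative_def]] .
  have Q: "((\<lambda>x. q (x $ 1)) has_derivative (\<lambda>h. q' * h $ 1)) (at x)"
    using has_derivative_compose[OF nth q[unfolded has_field_derivative_def]] .
  have R: "((\<lambda>x. r (x $ 2)) has_derivative (\<lambda>h. h $ 2 *\<^sub>R r')) (at x)"
    using has_derivative_compose[OF nth r[unfolded has_vector_derivative_def]] .
  show ?thesis
    unfolding tensor_def[abs_def]
    by (rule has_derivative_eq_rhs[OF has_derivative_scaleR[OF has_derivative_mult[OF P Q] R]])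
       (simp add: fun_eq_iff algebra_simps scaleR_add_left)
qed

context
  fixes P Q :: "nat \<Rightarrow> real \<Rightarrow> real" and R :: "nat \<Rightarrow> real \<Rightarrow> complex"
  assumes P: "\<And>k t. k < 2 \<Longrightarrow> (P k has_real_derivative P (Suc k) t) (at t)"
    and Q: "\<And>k t. k < 2 \<Longrightarrow> (Q k has_real_derivative Q (Suc k) t) (at t)"
    and R: "\<And>k t. k < 2 \<Longrightarrow> t > 0 \<Longrightarrow> (R k has_vector_derivative R (Suc k) t) (at t)"
    and cont: "continuous_on UNIV (P 2)" "continuous_on UNIV (Q 2)" "continuous_on {0<..} (R 2)"
begin

text \<open>Since \<open>P k\<close>, \<open>Q k\<close>, \<open>R k\<close> are the k-th
  derivatives of the three factors, a partial derivative is again a tensor with one index raised.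
  All nine second derivatives are thereby handled by one formula.\<close>

lemma tensor_partial:
  assumes "i < 2" "j < 2" "k < 2" "x \<in> upper_half_space"
  shows "tensor (P i) (Q j) (R k) differentiable (at x)"
    and "partial d (tensor (P i) (Q j) (R k)) x
           = tensor (P (i + incr d 0)) (Q (j + incr d 1)) (R (k + incr d 2)) x"
proof -
  have "x $ 2 > 0" using assms(4) by (simp add: upper_half_space_def)
  note der = tensor_has_derivative[where x = x, OF P[OF assms(1)] Q[OF assms(2)] R[OF assms(3) this]]
  show "tensor (P i) (Q j) (R k) differentiable (at x)"
    using der unfolding differentiable_def by blast
  show "partial d (tensor (P i) (Q j) (R k)) x
           = tensor (P (i + incr d 0)) (Q (j + incr d 1)) (R (k + incr d 2)) x"
    unfolding partial_def frechet_derivative_at[OF der, symmetric]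
    using exhaust_3_from_0[of d] by (auto simp: axis_def incr_def tensor_def)
qed

lemma tensor_continuous:
  assumes "i \<le> 2" "j \<le> 2" "k \<le> 2"
  shows "continuous_on upper_half_space (tensor (P i) (Q j) (R k))"
proof -
  have "continuous_on UNIV (P i)"
  proof (cases "i = 2")
    case False
    thus ?thesis using P[of i] assms(1) by (intro DERIV_continuous_on[of _ "P i"]) auto
  qed (use cont in simp)
  moreover have "continuous_on UNIV (Q j)"
  proof (cases "j = 2")
    case False
    thus ?thesis using Q[of j] assms(2) by (intro DERIV_continuous_on[of _ "Q j"]) auto
  qed (use cont in simp)
  moreover have "continuous_on {0<..} (R k)"
  proof (cases "k = 2")
    case False
    hence "isCont (R k) t" if "t > 0" for t
      using R[of k t] that assms(3) by (auto intro: has_vector_derivative_continuous)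
    thus ?thesis by (intro continuous_at_imp_continuous_on) auto
  qed (use cont in simp)
  ultimately show ?thesis
    unfolding tensor_def[abs_def] upper_half_space_def
    by (intro continuous_on_scaleR continuous_on_mult)
       (rule continuous_on_compose2[where g = "P i"] continuous_on_compose2[where g = "Q j"]
          continuous_on_compose2[where g = "R k"], assumption, intro continuous_intros, force)+
qed

lemma tensor_partial2:
  assumes "x \<in> upper_half_space"
  shows "partial d (tensor (P 0) (Q 0) (R 0)) differentiable (at x)"
    and "partial e (partial d (tensor (P 0) (Q 0) (R 0))) x
           = tensor (P (incr d 0 + incr e 0)) (Q (incr d 1 + incr e 1)) (R (incr d 2 + incr e 2)) x"
proof -
  let ?T = "tensor (P (incr d 0)) (Q (incr d 1)) (R (incr d 2))"
  have less: "incr d c < 2" for c by (simp add: incr_def)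
  have eq: "partial d (tensor (P 0) (Q 0) (R 0)) y = ?T y" if "y \<in> upper_half_space" for y
    using tensor_partial(2)[of 0 0 0 y d] that by simp
  note T = tensor_partial[OF less[of 0] less[of 1] less[of 2] assms]
  show *: "partial d (tensor (P 0) (Q 0) (R 0)) differentiable (at x)"
    by (rule differentiable_cong_open[OF T(1) open_upper_half_space assms]) (simp add: eq)
  show "partial e (partial d (tensor (P 0) (Q 0) (R 0))) x
           = tensor (P (incr d 0 + incr e 0)) (Q (incr d 1 + incr e 1)) (R (incr d 2 + incr e 2)) x"
    unfolding T(2)[symmetric] by (rule partial_cong_open[OF * open_upper_half_space assms eq])
qed

lemma C2_on_tensor: "C2_on (tensor (P 0) (Q 0) (R 0)) upper_half_space"
  unfolding C2_on_def
proof (intro conjI ballI allI)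
  show "tensor (P 0) (Q 0) (R 0) differentiable (at x)" if "x \<in> upper_half_space" for x
    using that by (intro tensor_partial) auto
  show "partial d (tensor (P 0) (Q 0) (R 0)) differentiable (at x)" if "x \<in> upper_half_space" for x d
    using that by (rule tensor_partial2)
  show "continuous_on upper_half_space (partial e (partial d (tensor (P 0) (Q 0) (R 0))))" for d e
  proof (rule continuous_on_eq)
    show "continuous_on upper_half_space (tensor (P (incr d 0 + incr e 0)) (Q (incr d 1 + incr e 1)) (R (incr d 2 + incr e 2)))"
      by (rule tensor_continuous) (auto simp: incr_def)
  qed (simp add: tensor_partial2)
qed

end

section \<open>Transfer and summation of solutions\<close>

lemma C2_on_cong_open:
  assumes "open S" "C2_on f S" and eq: "\<And>x. x \<in> S \<Longrightarrow> f x = g x"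
  shows "C2_on g S"
    and "x \<in> S \<Longrightarrow> partial i g x = partial i f x"
    and "x \<in> S \<Longrightarrow> partial j (partial i g) x = partial j (partial i f) x"
proof -
  have f: "f differentiable (at x)" "partial i f differentiable (at x)" "continuous_on S (partial j (partial i f))"
    if "x \<in> S" for x i j
    using assms(2) that by (auto simp: C2_on_def)
  have 1: "g differentiable (at x)" "partial i g x = partial i f x" if "x \<in> S" for x i
    using differentiable_cong_open[OF f(1)[OF that] assms(1) that eq]
      partial_cong_open[OF f(1)[OF that] assms(1) that eq] by simp_all
  have 2: "partial i g differentiable (at x)" "partial j (partial i g) x = partial j (partial i f) x"
    if "x \<in> S" for x i j
    using differentiable_cong_open[OF f(2)[OF that] assms(1) that 1(2)[symmetric]]
      partial_cong_open[OF f(2)[OF that] assms(1) that 1(2)[symmetric]] by simp_all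
  show "x \<in> S \<Longrightarrow> partial i g x = partial i f x"
    and "x \<in> S \<Longrightarrow> partial j (partial i g) x = partial j (partial i f) x"
    using 1 2 by blast+
  have "continuous_on S (partial j (partial i g))" for i j
  proof (cases "S = {}")
    case False
    hence "continuous_on S (partial j (partial i f))" using f(3) by blast
    thus ?thesis by (rule continuous_on_eq) (simp add: 2)
  qed simp
  thus "C2_on g S"
    unfolding C2_on_def using 1 2 by blast
qed

text \<open>The infinite sum over the integers is compared with a series over the naturals, and
  their equality is known only on the half-space, where the hypothesis gives summability.\<close>

lemma weinstein_solution_cong:
  assumes "weinstein_solution \<alpha> f" "\<And>x. x \<in> upper_half_space \<Longrightarrow> f x = g x"
  shows "weinstein_solution \<alpha> g"
  using assms(1) C2_on_cong_open[OF open_upper_half_space _ assms(2)]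
  unfolding weinstein_solution_def laplacian_def by simp

lemma weinstein_solution_series:
  assumes sol: "\<And>n. weinstein_solution \<alpha> (f n)"
    and loc: "\<And>x. x \<in> upper_half_space \<Longrightarrow> \<exists>e>0. \<exists>M. summable M \<and>
        (\<forall>n. \<forall>y\<in>ball x e. norm (f n y) \<le> M n \<and> (\<forall>i. norm (partial i (f n) y) \<le> M n) \<and>
           (\<forall>i j. norm (partial j (partial i (f n)) y) \<le> M n))"
  shows "weinstein_solution \<alpha> (\<lambda>x. \<Sum>n. f n x)"
proof -
  have C2: "C2_on (f n) upper_half_space" for n
    using sol[of n] by (simp add: weinstein_solution_def)
  note ser = C2_on_series[OF open_upper_half_space C2 loc]
  have "x $ 2 *\<^sub>R laplacian (\<lambda>x. \<Sum>n. f n x) x - \<alpha> *\<^sub>R partial 2 (\<lambda>x. \<Sum>n. f n x) x = 0"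
    if x: "x \<in> upper_half_space" for x
  proof -
    obtain e M where e: "e > 0" "summable M"
      and M: "\<And>n y i. y \<in> ball x e \<Longrightarrow> norm (partial i (f n) y) \<le> M n"
        "\<And>n y i j. y \<in> ball x e \<Longrightarrow> norm (partial j (partial i (f n)) y) \<le> M n"
      using loc[OF x] by meson
    have s: "summable (\<lambda>n. partial i (f n) x)" "summable (\<lambda>n. partial i (partial i (f n)) x)" for i
      by (rule summable_comparison_test'[OF e(2)]; use M e(1) in simp)+
    have "laplacian (\<lambda>x. \<Sum>n. f n x) x = (\<Sum>n. laplacian (f n) x)"
      unfolding laplacian_def by (simp add: ser(3)[OF _ x] suminf_sum[OF s(2)])
    moreover have "partial 2 (\<lambda>x. \<Sum>n. f n x) x = (\<Sum>n. partial 2 (f n) x)"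
      by (rule ser(2)[OF _ x])
    moreover have "summable (\<lambda>n. laplacian (f n) x)"
      unfolding laplacian_def by (intro summable_sum s(2))
    ultimately have "x $ 2 *\<^sub>R laplacian (\<lambda>x. \<Sum>n. f n x) x - \<alpha> *\<^sub>R partial 2 (\<lambda>x. \<Sum>n. f n x) x
        = (\<Sum>n. x $ 2 *\<^sub>R laplacian (f n) x - \<alpha> *\<^sub>R partial 2 (f n) x)"
      using s(1)[of 2] by (simp add: suminf_diff suminf_scaleR_right summable_scaleR_right)
    also have "\<dots> = 0"
      using sol x by (simp add: weinstein_solution_def)
    finally show ?thesis .
  qed
  thus ?thesis
    unfolding weinstein_solution_def using ser(1) by blast
qed

section \<open>Weinstein solutions from separated variables\<close>

lemma D1_D2_eq:
  assumes "open S"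
    and f: "\<And>t. t \<in> S \<Longrightarrow> (f has_vector_derivative f1 t) (at t)"
    and f1: "\<And>t. t \<in> S \<Longrightarrow> (f1 has_vector_derivative f2 t) (at t)"
  shows "twice_differentiable_on f S"
    and "t \<in> S \<Longrightarrow> D1 f t = f1 t" and "t \<in> S \<Longrightarrow> D2 f t = f2 t"
proof -
  have 1: "D1 f t = f1 t" if "t \<in> S" for t
    unfolding D1_def by (rule vector_derivative_at[OF f[OF that]])
  have 2: "(D1 f has_vector_derivative f2 t) (at t)" if "t \<in> S" for t
    by (rule has_vector_derivative_transform_within_open[OF f1[OF that] assms(1) that]) (simp add: 1)
  show "t \<in> S \<Longrightarrow> D1 f t = f1 t" by (rule 1)
  show "t \<in> S \<Longrightarrow> D2 f t = f2 t"
    unfolding D2_def D1_def[of "D1 f"] by (rule vector_derivative_at[OF 2])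
  show "twice_differentiable_on f S"
    unfolding twice_differentiable_on_def using f 2 differentiableI_vector by blast
qed

lemma weinstein_ode_Upsilon_sol:
  assumes "(real_of_int l)\<^sup>2 \<noteq> \<beta>\<^sup>2"
  shows "\<exists>u1. weinstein_ode \<alpha> ((real_of_int l)\<^sup>2 - \<beta>\<^sup>2) (Upsilon_sol \<alpha> A1 A2 l \<beta>) u1"
proof -
  define \<nu> where "\<nu> = complex_of_real ((\<alpha> + 1) / 2)"
  define k where "k = (real_of_int l)\<^sup>2 - \<beta>\<^sup>2"
  \<comment> \<open>A square root of -k in both cases, nonzero because l^2 and \<beta>^2
    differ.\<close>
  define c where "c = (if (real_of_int l)\<^sup>2 < \<beta>\<^sup>2 then complex_of_real (sqrt (- k)) else \<i> * complex_of_real (sqrt k))"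
  have c: "c \<noteq> 0" "complex_of_real k = - c\<^sup>2"
    using assms by (auto simp: c_def k_def power_mult_distrib simp flip: of_real_power)
  obtain u1 where u1: "weinstein_ode \<alpha> k (\<lambda>x. x powr ((\<alpha> + 1) / 2) * bessel_J \<nu> (c * complex_of_real x)) u1"
    using weinstein_ode_bessel_J[OF \<nu>_def c refl] by blast
  obtain u2 where u2: "weinstein_ode \<alpha> k (\<lambda>x. x powr ((\<alpha> + 1) / 2) * bessel_Y \<nu> (c * complex_of_real x)) u2"
    using weinstein_ode_bessel_Y[OF \<nu>_def c] by blast
  have "Upsilon_sol \<alpha> A1 A2 l \<beta> = (\<lambda>x. A1 l \<beta> * (x powr ((\<alpha> + 1) / 2) * bessel_J \<nu> (c * complex_of_real x))
      + A2 l \<beta> * (x powr ((\<alpha> + 1) / 2) * bessel_Y \<nu> (c * complex_of_real x)))"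
    by (simp add: fun_eq_iff Upsilon_sol_def Let_def c_def k_def \<nu>_def scaleR_conv_of_real distrib_left mult_ac)
  thus ?thesis
    using weinstein_ode_lincomb[OF u1 u2, of "A1 l \<beta>" "A2 l \<beta>"] unfolding k_def by auto
qed

text \<open>The derivatives of each factor as a family indexed by the order, the form in which
  \<open>tensor_partial\<close> takes them. The last clause is the second derivative, read off from
  the equation of the factor; for larger indices it only makes the function total.\<close>

fun Xi_deriv :: "(real \<Rightarrow> real) \<Rightarrow> (real \<Rightarrow> real) \<Rightarrow> real \<Rightarrow> nat \<Rightarrow> real \<Rightarrow> real" where
  "Xi_deriv B1 B2 \<beta> 0 t = Xi_sol B1 B2 \<beta> t"
| "Xi_deriv B1 B2 \<beta> (Suc 0) t = \<beta> * (B1 \<beta> * sinh (\<beta> * t) + B2 \<beta> * cosh (\<beta> * t))"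
| "Xi_deriv B1 B2 \<beta> (Suc (Suc k)) t = \<beta>\<^sup>2 * Xi_sol B1 B2 \<beta> t"

fun s_deriv :: "(int \<Rightarrow> real) \<Rightarrow> (int \<Rightarrow> real) \<Rightarrow> int \<Rightarrow> nat \<Rightarrow> real \<Rightarrow> real" where
  "s_deriv C1 C2 l 0 t = s_sol C1 C2 l t"
| "s_deriv C1 C2 l (Suc 0) t = of_int l * (C2 l * cos (of_int l * t) - C1 l * sin (of_int l * t))"
| "s_deriv C1 C2 l (Suc (Suc k)) t = - ((of_int l)\<^sup>2 * s_sol C1 C2 l t)"

fun ode_deriv :: "real \<Rightarrow> real \<Rightarrow> (real \<Rightarrow> complex) \<Rightarrow> (real \<Rightarrow> complex) \<Rightarrow> nat \<Rightarrow> real \<Rightarrow> complex" where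
  "ode_deriv \<alpha> k u u1 0 x = u x"
| "ode_deriv \<alpha> k u u1 (Suc 0) x = u1 x"
| "ode_deriv \<alpha> k u u1 (Suc (Suc n)) x = (\<alpha> / x) *\<^sub>R u1 x + k *\<^sub>R u x"

lemma le_2_cases: "(k::nat) \<le> 2 \<Longrightarrow> k = 0 \<or> k = Suc 0 \<or> k = Suc (Suc 0)"
  by auto

lemma Xi_deriv_has_derivative:
  "k < 2 \<Longrightarrow> (Xi_deriv B1 B2 \<beta> k has_real_derivative Xi_deriv B1 B2 \<beta> (Suc k) t) (at t)"
  by (drule less_2_cases)
     (auto simp: Xi_deriv.simps[abs_def] Xi_sol_def power2_eq_square algebra_simps intro!: derivative_eq_intros)

lemma s_deriv_has_derivative:
  "k < 2 \<Longrightarrow> (s_deriv C1 C2 l k has_real_derivative s_deriv C1 C2 l (Suc k) t) (at t)"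
  by (drule less_2_cases)
     (auto simp: s_deriv.simps[abs_def] s_sol_def power2_eq_square algebra_simps intro!: derivative_eq_intros)

lemma ode_deriv_has_derivative:
  "weinstein_ode \<alpha> k u u1 \<Longrightarrow> n < 2 \<Longrightarrow> x > 0 \<Longrightarrow>
     (ode_deriv \<alpha> k u u1 n has_vector_derivative ode_deriv \<alpha> k u u1 (Suc n) x) (at x)"
  by (drule less_2_cases) (auto simp: weinstein_ode_def ode_deriv.simps[abs_def])

lemma continuous_on_Xi_deriv: "n \<le> 2 \<Longrightarrow> continuous_on UNIV (Xi_deriv B1 B2 \<beta> n)"
  by (drule le_2_cases) (auto simp: Xi_deriv.simps[abs_def] Xi_sol_def intro!: continuous_intros)

lemma continuous_on_s_deriv: "n \<le> 2 \<Longrightarrow> continuous_on UNIV (s_deriv C1 C2 l n)"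
  by (drule le_2_cases) (auto simp: s_deriv.simps[abs_def] s_sol_def intro!: continuous_intros)

lemma continuous_on_ode_deriv:
  assumes "weinstein_ode \<alpha> k u u1" "n \<le> 2"
  shows "continuous_on {0<..} (ode_deriv \<alpha> k u u1 n)"
proof -
  have "continuous_on {0<..} u" "continuous_on {0<..} u1"
    using assms(1) unfolding weinstein_ode_def
    by (auto intro!: continuous_at_imp_continuous_on has_vector_derivative_continuous)
  thus ?thesis
    using le_2_cases[OF assms(2)] by (auto simp: ode_deriv.simps[abs_def] intro!: continuous_intros)
qed

lemma abs_s_deriv_le:
  assumes "n \<le> 2"
  shows "\<bar>s_deriv C1 C2 l n t\<bar> \<le> \<bar>real_of_int l\<bar> ^ n * (\<bar>C1 l\<bar> + \<bar>C2 l\<bar>)"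
proof -
  have 1: "\<bar>C1 l * y\<bar> \<le> \<bar>C1 l\<bar>" "\<bar>C2 l * y\<bar> \<le> \<bar>C2 l\<bar>" if "\<bar>y\<bar> \<le> 1" for y
    using mult_left_mono[OF that, of "\<bar>C1 l\<bar>"] mult_left_mono[OF that, of "\<bar>C2 l\<bar>"] by (auto simp: abs_mult)
  let ?c = "cos (of_int l * t)" and ?s = "sin (of_int l * t)"
  have "\<bar>C1 l * ?c\<bar> \<le> \<bar>C1 l\<bar>" "\<bar>C1 l * ?s\<bar> \<le> \<bar>C1 l\<bar>" "\<bar>C2 l * ?c\<bar> \<le> \<bar>C2 l\<bar>" "\<bar>C2 l * ?s\<bar> \<le> \<bar>C2 l\<bar>"
    by (simp_all add: 1)
  hence *: "\<bar>C1 l * ?c + C2 l * ?s\<bar> \<le> \<bar>C1 l\<bar> + \<bar>C2 l\<bar>" "\<bar>C2 l * ?c - C1 l * ?s\<bar> \<le> \<bar>C1 l\<bar> + \<bar>C2 l\<bar>"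
    by linarith+
  from le_2_cases[OF assms] show ?thesis
  proof (elim disjE)
    assume "n = 0"
    thus ?thesis using *(1) by (simp add: s_sol_def)
  next
    assume "n = Suc 0"
    thus ?thesis
      using mult_left_mono[OF *(2), of "\<bar>of_int l\<bar>"] by (simp add: abs_mult)
  next
    assume "n = Suc (Suc 0)"
    thus ?thesis
      using mult_left_mono[OF *(1), of "\<bar>of_int l\<bar> * \<bar>of_int l\<bar>"]
      by (simp add: s_sol_def abs_mult power2_eq_square mult.assoc)
  qed
qed

text \<open>For large \<open>k\<close> the coefficients of the \<open>x\<^sub>1\<close>-derivatives, powers of \<open>l\<close>, are absorbed by
  the decay of the solution away from the endpoints \<open>a\<close> and \<open>b\<close>.\<close>

lemma ode_deriv_weighted_bound:
  fixes \<alpha> \<beta> x0 :: real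
  assumes x0: "x0 > 0"
  obtains D where "D \<ge> 0"
    "\<And>l k u u1 x m n. weinstein_ode \<alpha> k u u1 \<Longrightarrow> k = (real_of_int l)\<^sup>2 - \<beta>\<^sup>2 \<Longrightarrow> k \<ge> 1 \<Longrightarrow> m + n \<le> 2 \<Longrightarrow>
       x \<in> {x0 / 2..3 * x0 / 2} \<Longrightarrow>
       \<bar>real_of_int l\<bar> ^ m * norm (ode_deriv \<alpha> k u u1 n x) \<le> D * (norm (u (x0 / 4)) + norm (u (15 * x0 / 8)))"
proof -
  \<comment> \<open>With a = x0/4, r = x0/8 and b = 15 x0/8 the interior interval from a + 2 r to b
    - 3 r is exactly [x0/2, 3 x0/2].\<close>
  obtain C where C0: "C \<ge> 0" and C: "\<And>k u u1 x. weinstein_ode \<alpha> k u u1 \<Longrightarrow> k \<ge> 1 \<Longrightarrow>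
      x \<in> {x0 / 4 + 2 * (x0 / 8)..15 * x0 / 8 - 3 * (x0 / 8)} \<Longrightarrow>
       norm (u x) \<le> C * (norm (u (x0 / 4)) + norm (u (15 * x0 / 8))) / k\<^sup>2 \<and>
       norm (u1 x) \<le> C * (norm (u (x0 / 4)) + norm (u (15 * x0 / 8))) / k"
    by (rule weinstein_ode_interior_estimate[of "x0 / 4" "x0 / 8" \<alpha> "15 * x0 / 8"]) (use x0 in auto)
  \<comment> \<open>The first summand pays for the powers of l, the second for the second derivative
    expressed by the equation.\<close>
  define D where "D = C * (1 + \<beta>\<^sup>2) + C * (\<bar>\<alpha>\<bar> / (x0 / 2) + 1)"
  show ?thesis
  proof (rule that)
    show "D \<ge> 0" using C0 x0 by (simp add: D_def)
    fix l k u u1 x and m n :: nat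
    assume u: "weinstein_ode \<alpha> k u u1" and kl: "k = (real_of_int l)\<^sup>2 - \<beta>\<^sup>2" and k: "k \<ge> 1"
      and mn: "m + n \<le> 2" and x: "x \<in> {x0 / 2..3 * x0 / 2}"
    define N where "N = norm (u (x0 / 4)) + norm (u (15 * x0 / 8))"
    have N0: "N \<ge> 0" by (simp add: N_def)
    have CN: "C * N \<ge> 0" using C0 N0 by simp
    have b: "norm (u x) \<le> C * N / k\<^sup>2" "norm (u1 x) \<le> C * N / k"
      unfolding N_def using C[OF u k] x by auto
    have b2: "norm (u x) \<le> C * N / k"
    proof -
      have "k \<le> k\<^sup>2" using k by (simp add: power2_eq_square)
      hence "C * N / k\<^sup>2 \<le> C * N / k"
        using k CN by (intro divide_left_mono) auto
      thus ?thesis using b(1) by linarith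
    qed
    let ?L = "\<bar>real_of_int l\<bar>"
    have L1: "?L \<ge> 1"
    proof -
      have "l \<noteq> 0"
      proof
        assume "l = 0"
        thus False using k kl zero_le_power2[of \<beta>] by simp
      qed
      thus ?thesis by linarith
    qed
    \<comment> \<open>Since \<open>k \<ge> 1\<close>, the summand \<beta>^2 in l^2 = k + \<beta>^2
      is at most \<beta>^2 k.\<close>
    have L2: "?L\<^sup>2 \<le> (1 + \<beta>\<^sup>2) * k"
    proof -
      have "\<beta>\<^sup>2 * 1 \<le> \<beta>\<^sup>2 * k" using k by (intro mult_left_mono) auto
      thus ?thesis by (simp add: kl[symmetric] distrib_right) (use kl in linarith)
    qed
    have Lm: "?L ^ m \<le> (1 + \<beta>\<^sup>2) * k" if "m \<le> 2" for m
      using power_increasing[OF that L1] L2 by linarith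
    have D1: "C * N * (1 + \<beta>\<^sup>2) \<le> D * N" and D2: "(\<bar>\<alpha>\<bar> / (x0 / 2) + 1) * (C * N) \<le> D * N"
      using C0 N0 x0 by (simp_all add: D_def distrib_right distrib_left mult_ac)
    have main: "?L ^ m * y \<le> D * N" if "m \<le> 2" "y \<ge> 0" "y \<le> C * N / k" for m y
    proof -
      have "?L ^ m * y \<le> (1 + \<beta>\<^sup>2) * k * (C * N / k)"
        using that Lm k by (intro mult_mono) auto
      also have "\<dots> = C * N * (1 + \<beta>\<^sup>2)" using k by simp
      finally show ?thesis using D1 by linarith
    qed
    \<comment> \<open>The second derivative contains k u, which decays only like 1/k; no power of l
      is left to absorb, as then m = 0.\<close>
    consider "n = 0" | "n = Suc 0" | "n = Suc (Suc 0)" "m = 0"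
      using mn by linarith
    thus "?L ^ m * norm (ode_deriv \<alpha> k u u1 n x) \<le> D * (norm (u (x0 / 4)) + norm (u (15 * x0 / 8)))"
      unfolding N_def[symmetric]
    proof cases
      case 1
      thus "?L ^ m * norm (ode_deriv \<alpha> k u u1 n x) \<le> D * N" using main[of m "norm (u x)"] mn b2 by simp
    next
      case 2
      thus "?L ^ m * norm (ode_deriv \<alpha> k u u1 n x) \<le> D * N" using main[of m "norm (u1 x)"] mn b(2) by simp
    next
      case 3
      have "norm ((\<alpha> / x) *\<^sub>R u1 x + k *\<^sub>R u x) \<le> \<bar>\<alpha>\<bar> / x * norm (u1 x) + k * norm (u x)"
        using norm_triangle_ineq[of "(\<alpha> / x) *\<^sub>R u1 x" "k *\<^sub>R u x"] x x0 k by simp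
      also have "\<dots> \<le> \<bar>\<alpha>\<bar> / (x0 / 2) * (C * N) + k * (C * N / k\<^sup>2)"
      proof -
        have "C * N / k \<le> C * N"
          using k CN by (simp add: divide_le_eq mult_le_cancel_left1)
        hence "norm (u1 x) \<le> C * N" using b(2) by linarith
        moreover have "\<bar>\<alpha>\<bar> / x \<le> \<bar>\<alpha>\<bar> / (x0 / 2)"
          using x x0 by (intro divide_left_mono) auto
        ultimately show ?thesis
          using k x0 CN b(1) x by (intro add_mono mult_mono) auto
      qed
      also have "k * (C * N / k\<^sup>2) \<le> C * N"
        using k CN by (simp add: power2_eq_square divide_le_eq mult_le_cancel_left1)
      finally have "norm ((\<alpha> / x) *\<^sub>R u1 x + k *\<^sub>R u x) \<le> (\<bar>\<alpha>\<bar> / (x0 / 2) + 1) * (C * N)"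
        by (simp add: distrib_right)
      thus "?L ^ m * norm (ode_deriv \<alpha> k u u1 n x) \<le> D * N"
        using 3 D2 by simp
    qed
  qed
qed

lemma finite_exceptional: "finite {l::int. (real_of_int l)\<^sup>2 - \<beta>\<^sup>2 < 1}"
proof (rule finite_subset[OF _ finite_int_abs_less[of "\<bar>\<beta>\<bar> + 2"]], safe)
  fix l :: int assume "(real_of_int l)\<^sup>2 - \<beta>\<^sup>2 < 1"
  hence "\<bar>real_of_int l\<bar>\<^sup>2 < (\<bar>\<beta>\<bar> + 2)\<^sup>2"
    by (simp add: power2_sum)
  thus "real_of_int \<bar>l\<bar> < \<bar>\<beta>\<bar> + 2"
    using power_less_imp_less_base[of "\<bar>real_of_int l\<bar>" 2 "\<bar>\<beta>\<bar> + 2"] by simp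
qed

text \<open>With \<Xi>'' = \<beta>^2 \<Xi>, s'' = -l^2 s and the radial equation with k = l^2 -
  \<beta>^2, all four equations become algebraic identities.\<close>

lemma separation_relations:
  assumes u: "weinstein_ode \<alpha> ((real_of_int l)\<^sup>2 - \<beta>\<^sup>2) (Upsilon_sol \<alpha> A1 A2 l \<beta>) u1"
  shows "separation_relation_1 \<alpha> (real_of_int l) (g_sol \<alpha> A1 A2 B1 B2 l \<beta>) (s_sol C1 C2 l)"
    and "separation_relation_2 \<alpha> (real_of_int l) \<beta> (Xi_sol B1 B2 \<beta>) (Upsilon_sol \<alpha> A1 A2 l \<beta>)"
proof -
  define k where "k = (real_of_int l)\<^sup>2 - \<beta>\<^sup>2"
  let ?u = "Upsilon_sol \<alpha> A1 A2 l \<beta>" and ?X = "Xi_sol B1 B2 \<beta>" and ?s = "s_sol C1 C2 l"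
  let ?X1 = "Xi_deriv B1 B2 \<beta> (Suc 0)" and ?u2 = "\<lambda>x. (\<alpha> / x) *\<^sub>R u1 x + k *\<^sub>R ?u x"
  have X: "(?X has_vector_derivative ?X1 t) (at t)" "(?X1 has_vector_derivative \<beta>\<^sup>2 * ?X t) (at t)" for t
    using Xi_deriv_has_derivative[of 0 B1 B2 \<beta> t] Xi_deriv_has_derivative[of "Suc 0" B1 B2 \<beta> t]
    by (simp_all add: has_real_derivative_iff_has_vector_derivative Xi_deriv.simps(1,3)[abs_def] del: Xi_deriv.simps(2))
  have s: "(?s has_vector_derivative s_deriv C1 C2 l (Suc 0) t) (at t)"
    "(s_deriv C1 C2 l (Suc 0) has_vector_derivative - ((of_int l)\<^sup>2 * ?s t)) (at t)" for t
    using s_deriv_has_derivative[of 0 C1 C2 l t] s_deriv_has_derivative[of "Suc 0" C1 C2 l t]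
    by (simp_all add: has_real_derivative_iff_has_vector_derivative s_deriv.simps(1,3)[abs_def] del: s_deriv.simps(2))
  have u: "(?u has_vector_derivative u1 x) (at x)" "(u1 has_vector_derivative ?u2 x) (at x)" if "x \<in> {0<..}" for x
    using u that by (auto simp: weinstein_ode_def k_def)
  have gX: "((\<lambda>t. ?X t *\<^sub>R c) has_vector_derivative ?X1 t *\<^sub>R c) (at t)"
    "((\<lambda>t. ?X1 t *\<^sub>R c) has_vector_derivative (\<beta>\<^sup>2 * ?X t) *\<^sub>R c) (at t)" for t and c :: complex
    by (intro bounded_linear.has_vector_derivative[OF bounded_linear_scaleR_left] X)+
  have gu: "((\<lambda>t. c *\<^sub>R ?u t) has_vector_derivative c *\<^sub>R u1 x) (at x)"
    "((\<lambda>t. c *\<^sub>R u1 t) has_vector_derivative c *\<^sub>R ?u2 x) (at x)" if "x \<in> {0<..}" for x and c :: real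
    by (intro bounded_linear.has_vector_derivative[OF bounded_linear_scaleR_right] u that)+
  note dX = D1_D2_eq[OF open_UNIV X] and ds = D1_D2_eq[OF open_UNIV s] and dgX = D1_D2_eq[OF open_UNIV gX]
  have du: "twice_differentiable_on ?u {0<..}"
    by (rule D1_D2_eq(1)[OF open_greaterThan u])
  have du': "D1 ?u x = u1 x" "D2 ?u x = ?u2 x" if "x \<in> {0<..}" for x
    by (rule D1_D2_eq(2,3)[where S = "{0<..}", OF open_greaterThan u]; use that in simp)+
  have dgu: "twice_differentiable_on (\<lambda>t. c *\<^sub>R ?u t) {0<..}" for c :: real
    by (rule D1_D2_eq(1)[OF open_greaterThan gu])
  have dgu': "D1 (\<lambda>t. c *\<^sub>R ?u t) x = c *\<^sub>R u1 x" "D2 (\<lambda>t. c *\<^sub>R ?u t) x = c *\<^sub>R ?u2 x"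
    if "x \<in> {0<..}" for x and c :: real
    by (rule D1_D2_eq(2,3)[where S = "{0<..}", OF open_greaterThan gu]; use that in simp)+
  show "separation_relation_1 \<alpha> (real_of_int l) (g_sol \<alpha> A1 A2 B1 B2 l \<beta>) ?s"
    unfolding separation_relation_1_def g_sol_def
  proof (intro conjI allI impI)
    fix x0 x1 x2 :: real assume "x2 > 0"
    hence x2: "x2 \<in> {0<..}" by simp
    show "- (D2 ?s x1 *\<^sub>R ?X x0 *\<^sub>R ?u x2) =
       ?s x1 *\<^sub>R (D2 (\<lambda>t. ?X t *\<^sub>R ?u x2) x0 + D2 (\<lambda>t. ?X x0 *\<^sub>R ?u t) x2)
         - (\<alpha> * ?s x1 / x2) *\<^sub>R D1 (\<lambda>t. ?X x0 *\<^sub>R ?u t) x2"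
      "?s x1 *\<^sub>R (D2 (\<lambda>t. ?X t *\<^sub>R ?u x2) x0 + D2 (\<lambda>t. ?X x0 *\<^sub>R ?u t) x2)
         - (\<alpha> * ?s x1 / x2) *\<^sub>R D1 (\<lambda>t. ?X x0 *\<^sub>R ?u t) x2
         = ((real_of_int l)\<^sup>2 * ?s x1) *\<^sub>R ?X x0 *\<^sub>R ?u x2"
      unfolding ds(3)[OF UNIV_I] dgX(3)[OF UNIV_I] dgu'[OF x2] k_def
      by (simp_all add: scaleR_conv_of_real algebra_simps)
  qed (rule dX ds dgX dgu)+
  show "separation_relation_2 \<alpha> (real_of_int l) \<beta> ?X ?u"
    unfolding separation_relation_2_def
  proof (intro conjI allI impI)
    fix x0 x2 :: real assume "x2 > 0"
    hence x2: "x2 \<in> {0<..}" by simp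
    show "- (D2 ?X x0 *\<^sub>R ?u x2) = ?X x0 *\<^sub>R D2 ?u x2 - (\<alpha> * ?X x0 / x2) *\<^sub>R D1 ?u x2
        - ((real_of_int l)\<^sup>2 * ?X x0) *\<^sub>R ?u x2"
      "?X x0 *\<^sub>R D2 ?u x2 - (\<alpha> * ?X x0 / x2) *\<^sub>R D1 ?u x2
        - ((real_of_int l)\<^sup>2 * ?X x0) *\<^sub>R ?u x2 = - ((\<beta>\<^sup>2 * ?X x0) *\<^sub>R ?u x2)"
      unfolding dX(3)[OF UNIV_I] du'[OF x2] k_def
      by (simp_all add: scaleR_conv_of_real algebra_simps)
  qed (rule dX du)+
qed

lemma sum_UNIV_3_from_0: "(\<Sum>d\<in>(UNIV::3 set). f d) = f 0 + f 1 + f 2"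
proof -
  have *: "(3::3) = 0" by simp
  show ?thesis unfolding sum_3 * by (simp only: add_ac)
qed

section \<open>The summands of the solution and their series\<close>

context
  fixes \<alpha> \<beta> :: real and C1 C2 :: "int \<Rightarrow> real" and B1 B2 :: "real \<Rightarrow> real"
    and A1 A2 :: "int \<Rightarrow> real \<Rightarrow> real" and U1 :: "int \<Rightarrow> real \<Rightarrow> complex"
  assumes U1: "\<And>l. weinstein_ode \<alpha> ((real_of_int l)\<^sup>2 - \<beta>\<^sup>2) (Upsilon_sol \<alpha> A1 A2 l \<beta>) (U1 l)"
begin

abbreviation (input) "Upsilon_deriv l \<equiv> ode_deriv \<alpha> ((real_of_int l)\<^sup>2 - \<beta>\<^sup>2) (Upsilon_sol \<alpha> A1 A2 l \<beta>) (U1 l)"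
abbreviation (input) "h_summand l \<equiv> h_term \<alpha> A1 A2 B1 B2 C1 C2 \<beta> l"
abbreviation (input) "h_deriv l i j k \<equiv> tensor (Xi_deriv B1 B2 \<beta> i) (s_deriv C1 C2 l j) (Upsilon_deriv l k)"

lemma h_term_eq_tensor: "h_summand l = h_deriv l 0 0 0"
  by (rule ext) (simp add: h_term_def tensor_def g_sol_def mult.commute)

lemma h_term_C2:
  shows "C2_on (h_summand l) upper_half_space"
    and "x \<in> upper_half_space \<Longrightarrow> partial d (h_summand l) x = h_deriv l (incr d 0) (incr d 1) (incr d 2) x"
    and "x \<in> upper_half_space \<Longrightarrow> partial e (partial d (h_summand l)) x
      = h_deriv l (incr d 0 + incr e 0) (incr d 1 + incr e 1) (incr d 2 + incr e 2) x"
proof -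
  note hyps = Xi_deriv_has_derivative[of _ B1 B2 \<beta>] s_deriv_has_derivative[of _ C1 C2 l]
    ode_deriv_has_derivative[OF U1[of l]] continuous_on_Xi_deriv[OF order_refl, of B1 B2 \<beta>]
    continuous_on_s_deriv[OF order_refl, of C1 C2 l] continuous_on_ode_deriv[OF U1[of l] order_refl]
  show "C2_on (h_summand l) upper_half_space"
    unfolding h_term_eq_tensor by (rule C2_on_tensor[where P = "Xi_deriv B1 B2 \<beta>" and Q = "s_deriv C1 C2 l" and R = "Upsilon_deriv l"]) (fact hyps)+
  show "partial d (h_summand l) x = h_deriv l (incr d 0) (incr d 1) (incr d 2) x" if "x \<in> upper_half_space"
    unfolding h_term_eq_tensor
    using tensor_partial(2)[where P = "Xi_deriv B1 B2 \<beta>" and Q = "s_deriv C1 C2 l" and R = "Upsilon_deriv l" and i = 0 and j = 0 and k = 0, OF hyps _ _ _ that] by simp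
  show "partial e (partial d (h_summand l)) x
      = h_deriv l (incr d 0 + incr e 0) (incr d 1 + incr e 1) (incr d 2 + incr e 2) x" if "x \<in> upper_half_space"
    unfolding h_term_eq_tensor
    by (rule tensor_partial2(2)[where P = "Xi_deriv B1 B2 \<beta>" and Q = "s_deriv C1 C2 l" and R = "Upsilon_deriv l"]) (fact hyps that)+
qed

text \<open>The second derivatives contribute the factors \<beta>^2, -l^2 and k, which add up to
  zero; the remaining first-order term of the radial equation cancels the \<alpha>-term.\<close>

lemma weinstein_solution_h_term: "weinstein_solution \<alpha> (h_summand l)"
  unfolding weinstein_solution_def
proof (intro conjI ballI h_term_C2(1))
  fix x assume x: "x \<in> upper_half_space"
  hence "x $ 2 \<noteq> 0" by (simp add: upper_half_space_def)
  have "laplacian (h_summand l) x = h_deriv l 2 0 0 x + h_deriv l 0 2 0 x + h_deriv l 0 0 2 x"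
    unfolding laplacian_def sum_UNIV_3_from_0 h_term_C2(3)[OF x] by (simp add: incr_def numeral_2_eq_2)
  moreover have "partial 2 (h_summand l) x = h_deriv l 0 0 1 x"
    unfolding h_term_C2(2)[OF x] by (simp add: incr_def)
  ultimately show "x $ 2 *\<^sub>R laplacian (h_summand l) x - \<alpha> *\<^sub>R partial 2 (h_summand l) x = 0"
    using \<open>x $ 2 \<noteq> 0\<close>
    by (simp add: tensor_def numeral_2_eq_2 scaleR_conv_of_real divide_simps) (simp add: algebra_simps power2_eq_square)
qed

lemma weinstein_solution_h_sol_nonzero:
  assumes summable: "\<And>x. x \<in> upper_half_space \<Longrightarrow> (\<lambda>l. h_summand l x) summable_on UNIV"
    and t0: "Xi_sol B1 B2 \<beta> t0 \<noteq> 0"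
  shows "weinstein_solution \<alpha> (h_sol \<alpha> A1 A2 B1 B2 C1 C2 \<beta>)"
proof -
  let ?c = "\<lambda>l. \<bar>C1 l\<bar> + \<bar>C2 l\<bar>" and ?u = "\<lambda>l. Upsilon_sol \<alpha> A1 A2 l \<beta>"
  have amp: "(\<lambda>l. ?c l * norm (?u l z)) summable_on UNIV" if z: "z > 0" for z
  proof (rule summable_amplitudes)
    fix x1
    \<comment> \<open>The point lies over t0, where the factor in \<open>x$0\<close> is nonzero and
      can be divided out; x1 remains free for the Denjoy-Lusin argument.\<close>
    define x :: "real^3" where "x = (\<chi> i. if i = 0 then t0 else if i = 1 then x1 else z)"
    have comp: "x $ 0 = t0" "x $ 1 = x1" "x $ 2 = z"
      by (simp_all add: x_def)
    have "(\<lambda>l. h_summand l x) summable_on UNIV"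
      using z by (intro summable) (simp add: upper_half_space_def comp)
    \<comment> \<open>Unordered summability of complex numbers is absolute summability; this
      supplies the moduli required by \<open>summable_amplitudes\<close>.\<close>
    hence "(\<lambda>l. norm (h_summand l x)) summable_on UNIV"
      by (simp add: summable_on_iff_abs_summable_on_complex)
    hence "(\<lambda>l. 1 / \<bar>Xi_sol B1 B2 \<beta> t0\<bar> * norm (h_summand l x)) summable_on UNIV"
      by (rule summable_on_cmult_right)
    thus "(\<lambda>l. \<bar>C1 l * cos (of_int l * x1) + C2 l * sin (of_int l * x1)\<bar> * norm (?u l z)) summable_on UNIV"
      using t0 by (simp add: h_term_def g_sol_def s_sol_def comp abs_mult)
  qed simp
  have loc: "\<exists>e>0. \<exists>M. summable M \<and>
        (\<forall>n. \<forall>y\<in>ball x e. norm (h_summand (int_decode n) y) \<le> M n \<and> (\<forall>i. norm (partial i (h_summand (int_decode n)) y) \<le> M n) \<and>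
           (\<forall>i j. norm (partial j (partial i (h_summand (int_decode n))) y) \<le> M n))" if x: "x \<in> upper_half_space" for x
  proof -
    define z where "z = x $ 2"
    have z: "z > 0" using x by (simp add: upper_half_space_def z_def)
    let ?I = "{z / 2..3 * z / 2}" and ?J = "{x $ 0 - z / 2..x $ 0 + z / 2}"
    have coords: "y $ 2 \<in> ?I" "y $ 0 \<in> ?J" "y \<in> upper_half_space" if "y \<in> ball x (z / 2)" for y
    proof -
      have "\<bar>(x - y) $ i\<bar> < z / 2" for i
        using component_le_norm_cart[of "x - y" i] that by (simp add: dist_norm)
      from this[of 0] this[of 2] show "y $ 2 \<in> ?I" "y $ 0 \<in> ?J"
        by (auto simp: z_def abs_if split: if_splits)
      thus "y \<in> upper_half_space" using z by (simp add: upper_half_space_def)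
    qed
    obtain D where D: "D \<ge> 0"
      "\<And>l k u u1 x m n. weinstein_ode \<alpha> k u u1 \<Longrightarrow> k = (real_of_int l)\<^sup>2 - \<beta>\<^sup>2 \<Longrightarrow> k \<ge> 1 \<Longrightarrow> m + n \<le> 2 \<Longrightarrow>
       x \<in> ?I \<Longrightarrow>
       \<bar>real_of_int l\<bar> ^ m * norm (ode_deriv \<alpha> k u u1 n x) \<le> D * (norm (u (z / 4)) + norm (u (15 * z / 8)))"
    proof (rule ode_deriv_weighted_bound[where \<alpha> = \<alpha> and \<beta> = \<beta>, OF z], goal_cases)
      case (1 D)
      show ?case by (rule 1(1)[OF 1(2,3)])
    qed
    have "\<exists>b. \<forall>i\<le>2. \<forall>t\<in>?J. \<bar>Xi_deriv B1 B2 \<beta> i t\<bar> \<le> b"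
    proof -
      have "bounded (\<Union>i\<le>2. Xi_deriv B1 B2 \<beta> i ` ?J)"
        by (intro bounded_UN compact_imp_bounded compact_continuous_image ballI
              continuous_on_subset[OF continuous_on_Xi_deriv]) auto
      then obtain b where "\<forall>v\<in>(\<Union>i\<le>2. Xi_deriv B1 B2 \<beta> i ` ?J). norm v \<le> b"
        unfolding bounded_iff by blast
      thus ?thesis by (intro exI[of _ b]) auto
    qed
    then obtain G where G: "\<And>i t. i \<le> 2 \<Longrightarrow> t \<in> ?J \<Longrightarrow> \<bar>Xi_deriv B1 B2 \<beta> i t\<bar> \<le> G"
      by meson
    \<comment> \<open>A bound by compactness for each single l, with no control in l: it will be
      used for the finitely many l in \<open>F\<close> only.\<close>
    have "\<forall>l. \<exists>b. \<forall>m\<le>2. \<forall>k\<le>2. \<forall>t\<in>?I. \<bar>real_of_int l\<bar> ^ m * norm (Upsilon_deriv l k t) \<le> b"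
    proof
      fix l
      have "bounded (\<Union>m\<le>2. \<Union>k\<le>2. (\<lambda>t. \<bar>real_of_int l\<bar> ^ m *\<^sub>R Upsilon_deriv l k t) ` ?I)"
        using z by (intro bounded_UN compact_imp_bounded compact_continuous_image ballI continuous_intros
              continuous_on_subset[OF continuous_on_ode_deriv[OF U1]]) auto
      then obtain b where b: "\<forall>v\<in>(\<Union>m\<le>2. \<Union>k\<le>2. (\<lambda>t. \<bar>real_of_int l\<bar> ^ m *\<^sub>R Upsilon_deriv l k t) ` ?I). norm v \<le> b"
        unfolding bounded_iff by blast
      show "\<exists>b. \<forall>m\<le>2. \<forall>k\<le>2. \<forall>t\<in>?I. \<bar>real_of_int l\<bar> ^ m * norm (Upsilon_deriv l k t) \<le> b"
      proof (intro exI[of _ b] allI impI ballI)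
        fix m k :: nat and t assume "m \<le> 2" "k \<le> 2" "t \<in> ?I"
        hence "norm (\<bar>real_of_int l\<bar> ^ m *\<^sub>R Upsilon_deriv l k t) \<le> b"
          by (intro b[rule_format]) blast
        thus "\<bar>real_of_int l\<bar> ^ m * norm (Upsilon_deriv l k t) \<le> b" by simp
      qed
    qed
    from choice[OF this] obtain E where
      E: "\<forall>l. \<forall>m\<le>2. \<forall>k\<le>2. \<forall>t\<in>?I. \<bar>real_of_int l\<bar> ^ m * norm (Upsilon_deriv l k t) \<le> E l" by (elim exE)
    define F where "F = {l::int. (real_of_int l)\<^sup>2 - \<beta>\<^sup>2 < 1}"
    define N where "N l = norm (?u l (z / 4)) + norm (?u l (15 * z / 8))" for l
    define W where "W l = (if l \<in> F then E l else D * N l)" for l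
    define M where "M l = G * (?c l * W l)" for l
    have W: "\<bar>real_of_int l\<bar> ^ m * norm (Upsilon_deriv l k t) \<le> W l" if "m + k \<le> 2" "t \<in> ?I" for l m k t
    proof (cases "l \<in> F")
      case True
      thus ?thesis using E that by (simp add: W_def)
    next
      case False
      thus ?thesis
        using D(2)[OF U1 refl _ that, of l] by (simp add: W_def F_def N_def)
    qed
    have T_le: "norm (h_deriv l i j k y) \<le> M l" if "i \<le> 2" "j + k \<le> 2" "y \<in> ball x (z / 2)" for l i j k y
    proof -
      have G0: "G \<ge> 0"
        using G[OF that(1) coords(2)[OF that(3)]] by linarith
      have "norm (h_deriv l i j k y) = \<bar>Xi_deriv B1 B2 \<beta> i (y $ 0)\<bar> * (\<bar>s_deriv C1 C2 l j (y $ 1)\<bar> * norm (Upsilon_deriv l k (y $ 2)))"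
        by (simp add: tensor_def abs_mult)
      also have "\<dots> \<le> G * ((\<bar>real_of_int l\<bar> ^ j * ?c l) * norm (Upsilon_deriv l k (y $ 2)))"
        using that G0 by (intro mult_mono G coords abs_s_deriv_le mult_nonneg_nonneg) auto
      also have "\<dots> = G * (?c l * (\<bar>real_of_int l\<bar> ^ j * norm (Upsilon_deriv l k (y $ 2))))"
        by (simp only: mult_ac)
      also have "\<dots> \<le> M l"
        unfolding M_def using that G0 by (intro mult_left_mono W coords) auto
      finally show ?thesis .
    qed
    \<comment> \<open>\<open>E l\<close> is merely some upper bound, so the sign of
      \<open>M l\<close> is read off from the estimate at the centre of the ball.\<close>
    have M0: "M l \<ge> 0" for l
      using T_le[of 0 0 0 x l] z norm_ge_zero[of "h_deriv l 0 0 0 x"] by (simp only: centre_in_ball) linarith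
    have "(\<lambda>l. ?c l * norm (?u l (z / 4)) + ?c l * norm (?u l (15 * z / 8))) summable_on UNIV"
      using z by (intro summable_on_add amp) auto
    hence "(\<lambda>l. G * D * (?c l * norm (?u l (z / 4)) + ?c l * norm (?u l (15 * z / 8)))) summable_on UNIV"
      by (rule summable_on_cmult_right)
    hence tail: "(\<lambda>l. G * D * (?c l * norm (?u l (z / 4)) + ?c l * norm (?u l (15 * z / 8)))) summable_on - F"
      by (rule summable_on_subset_banach) simp
    have M_eq: "M l = G * D * (?c l * norm (?u l (z / 4)) + ?c l * norm (?u l (15 * z / 8)))" if "l \<in> - F" for l
      using that by (simp add: M_def W_def N_def algebra_simps)
    have "M summable_on - F"
      by (rule iffD2[OF summable_on_cong[OF M_eq] tail])
    moreover have "M summable_on F"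
      unfolding F_def by (rule summable_on_finite[OF finite_exceptional])
    ultimately have "M summable_on (F \<union> - F)"
      by (intro summable_on_Un_disjoint) auto
    hence "M summable_on UNIV"
      by (simp add: Compl_partition)
    \<comment> \<open>The differentiation lemmas concern series over the naturals; the integers are
      enumerated by \<open>int_decode\<close>, harmless under absolute convergence.\<close>
    hence "(\<lambda>n. M (int_decode n)) summable_on UNIV"
      by (simp add: summable_on_reindex_bij_betw[OF bij_int_decode])
    hence M_summable: "summable (\<lambda>n. M (int_decode n))"
      using M0 by (simp add: summable_on_UNIV_nonneg_real_iff)
    have bounds: "norm (h_summand l y) \<le> M l" "norm (partial d (h_summand l) y) \<le> M l" "norm (partial e (partial d (h_summand l)) y) \<le> M l"
      if y: "y \<in> ball x (z / 2)" for l d e y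
    proof -
      show "norm (h_summand l y) \<le> M l"
        unfolding h_term_eq_tensor by (rule T_le[OF _ _ y]) auto
      show "norm (partial d (h_summand l) y) \<le> M l"
        unfolding h_term_C2(2)[OF coords(3)[OF y]] using incr_sum[of d] by (intro T_le[OF _ _ y]) auto
      show "norm (partial e (partial d (h_summand l)) y) \<le> M l"
        unfolding h_term_C2(3)[OF coords(3)[OF y]] using incr_sum[of d] incr_sum[of e] by (intro T_le[OF _ _ y]) auto
    qed
    show ?thesis
    proof (rule exI[of _ "z / 2"], rule conjI)
      show "\<exists>M. summable M \<and> (\<forall>n. \<forall>y\<in>ball x (z / 2). norm (h_summand (int_decode n) y) \<le> M n \<and>
          (\<forall>i. norm (partial i (h_summand (int_decode n)) y) \<le> M n) \<and>
          (\<forall>i j. norm (partial j (partial i (h_summand (int_decode n))) y) \<le> M n))"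
        by (rule exI[of _ "\<lambda>n. M (int_decode n)"]) (intro conjI allI ballI M_summable bounds)
    qed (use z in simp)
  qed
  have "weinstein_solution \<alpha> (\<lambda>x. \<Sum>n. h_summand (int_decode n) x)"
    by (rule weinstein_solution_series[OF weinstein_solution_h_term loc])
  thus ?thesis
  proof (rule weinstein_solution_cong)
    fix x assume x: "x \<in> upper_half_space"
    have "(\<lambda>n. h_summand (int_decode n) x) summable_on UNIV"
      using summable[OF x] by (simp add: summable_on_reindex_bij_betw[OF bij_int_decode, of "\<lambda>l. h_summand l x"])
    hence "(\<lambda>n. h_summand (int_decode n) x) sums (\<Sum>\<^sub>\<infinity>n. h_summand (int_decode n) x)"
      by (intro has_sum_imp_sums has_sum_infsum)
    also have "(\<Sum>\<^sub>\<infinity>n. h_summand (int_decode n) x) = h_sol \<alpha> A1 A2 B1 B2 C1 C2 \<beta> x"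
      unfolding h_sol_def by (rule infsum_reindex_bij_betw[OF bij_int_decode])
    finally show "(\<Sum>n. h_summand (int_decode n) x) = h_sol \<alpha> A1 A2 B1 B2 C1 C2 \<beta> x"
      by (rule sums_unique[symmetric])
  qed
qed

text \<open>If the factor in \<open>x$0\<close> vanishes identically, it cannot be divided out, but
  then every summand is zero and the sum coincides with one of them, already known to be a
  solution.\<close>

lemma weinstein_solution_h_sol:
  assumes summable: "\<And>x. x \<in> upper_half_space \<Longrightarrow> (\<lambda>l. h_summand l x) summable_on UNIV"
  shows "weinstein_solution \<alpha> (h_sol \<alpha> A1 A2 B1 B2 C1 C2 \<beta>)"
proof (cases "\<exists>t. Xi_sol B1 B2 \<beta> t \<noteq> 0")
  case True
  then obtain t0 where t0: "Xi_sol B1 B2 \<beta> t0 \<noteq> 0" by blast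
  show ?thesis by (rule weinstein_solution_h_sol_nonzero[OF _ t0]) (rule summable)
next
  case False
  hence "h_summand l x = 0" for l x
    by (simp add: h_term_def g_sol_def)
  hence "h_sol \<alpha> A1 A2 B1 B2 C1 C2 \<beta> = h_summand 0"
    by (simp add: fun_eq_iff h_sol_def)
  thus ?thesis by (simp add: weinstein_solution_h_term)
qed

end

theorem theorem2p2:
  fixes \<alpha> \<beta> :: real
    and C1 C2 :: "int \<Rightarrow> real"
    and B1 B2 :: "real \<Rightarrow> real"
    and A1 A2 :: "int \<Rightarrow> real \<Rightarrow> real"
  assumes "\<beta> \<notin> \<int>"
  shows "(\<forall>l::int.
            separation_relation_1 \<alpha> (real_of_int l) (g_sol \<alpha> A1 A2 B1 B2 l \<beta>) (s_sol C1 C2 l) \<and>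
            separation_relation_2 \<alpha> (real_of_int l) \<beta> (Xi_sol B1 B2 \<beta>) (Upsilon_sol \<alpha> A1 A2 l \<beta>)) \<and>
         ((\<forall>x\<in>upper_half_space. (\<lambda>l. h_term \<alpha> A1 A2 B1 B2 C1 C2 \<beta> l x) summable_on UNIV) \<longrightarrow>
            weinstein_solution \<alpha> (h_sol \<alpha> A1 A2 B1 B2 C1 C2 \<beta>))"
proof -
  have "\<forall>l. \<exists>u1. weinstein_ode \<alpha> ((real_of_int l)\<^sup>2 - \<beta>\<^sup>2) (Upsilon_sol \<alpha> A1 A2 l \<beta>) u1"
  proof
    fix l
    \<comment> \<open>Since \<beta> is not an integer, the argument of the Bessel functions never
      degenerates to zero.\<close>
    have "(real_of_int l)\<^sup>2 \<noteq> \<beta>\<^sup>2"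
    proof
      assume "(real_of_int l)\<^sup>2 = \<beta>\<^sup>2"
      hence "\<beta> = real_of_int l \<or> \<beta> = real_of_int (- l)"
        by (auto simp: power2_eq_iff)
      thus False using assms by (metis Ints_of_int)
    qed
    thus "\<exists>u1. weinstein_ode \<alpha> ((real_of_int l)\<^sup>2 - \<beta>\<^sup>2) (Upsilon_sol \<alpha> A1 A2 l \<beta>) u1"
      by (rule weinstein_ode_Upsilon_sol)
  qed
  from choice[OF this] obtain U1 where
    U1: "\<forall>l. weinstein_ode \<alpha> ((real_of_int l)\<^sup>2 - \<beta>\<^sup>2) (Upsilon_sol \<alpha> A1 A2 l \<beta>) (U1 l)" by (elim exE)
  show ?thesis
    using separation_relations[OF U1[rule_format]] weinstein_solution_h_sol[of \<alpha> \<beta> A1 A2 U1 B1 B2 C1 C2, OF U1[rule_format]]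
    by blast
qed

end
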